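(* Let $S_{n-1}=\operatorname{conv}(e_1,\ldots,e_n)\subset\mathbb{R}^n$ and $C_n=\operatorname{conv}(\pm e_1,\ldots,\pm e_n)\subset\mathbb{R}^n$, where $e_1,\dots,e_n$ is the standard basis. For a convex compact $K\subset\mathbb{R}^n$ let $W_K=\sup_{t\in K}\langle U,t\rangle-\inf_{t\in K}\langle U,t\rangle$, where $U$ is uniformly distributed on the unit sphere $\mathbb{S}^{n-1}$. Let $$u_n = \sqrt{2\log n} - \frac{\frac 12 \log \log n +\log (2\sqrt{\pi})}{\sqrt{2\log n}}.$$ Then, as $n\to\infty$, in distribution, $$\sqrt{2n\log n} \left(W_{S_{n-1}} - \frac{2 u_{n}}{\sqrt n} \right) \to G_1+G_2,\qquad \sqrt{2n\log n} \left(W_{C_{n}} - \frac{2 u_{2n}}{\sqrt n} \right) \to 2G_1,$$ where $G_1,G_2$ are independent random variables with $\mathbb{P}[G_1\leq x]=\mathbb{P}[G_2\leq x]=e^{-e^{-x}}$, $x\in\mathbb{R}$. *)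

theory Defs
  imports "HOL-Probability.Probability"
begin

text \<open>Vectors of R^n are represented as functions nat => real; only the
  coordinates 0..n-1 matter.\<close>

definition std_basis :: "nat \<Rightarrow> nat \<Rightarrow> real" where
  "std_basis i = (\<lambda>j. if j = i then 1 else 0)"

definition conv_fin :: "(nat \<Rightarrow> real) set \<Rightarrow> (nat \<Rightarrow> real) set" where
  "conv_fin V = {x. \<exists>F a. finite F \<and> F \<subseteq> V \<and> F \<noteq> {} \<and> (\<forall>v\<in>F. a v \<ge> 0) \<and>
      sum a F = 1 \<and> x = (\<lambda>j. \<Sum>v\<in>F. a v * v j)}"

definition simplex_n :: "nat \<Rightarrow> (nat \<Rightarrow> real) set" where
  "simplex_n n = conv_fin (std_basis ` {..<n})"

definition crosspoly_n :: "nat \<Rightarrow> (nat \<Rightarrow> real) set" where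
  "crosspoly_n n = conv_fin ((\<lambda>(s, i). (\<lambda>j. s * std_basis i j)) ` ({1, -1} \<times> {..<n}))"

definition inner_n :: "nat \<Rightarrow> (nat \<Rightarrow> real) \<Rightarrow> (nat \<Rightarrow> real) \<Rightarrow> real" where
  "inner_n n x y = (\<Sum>i<n. x i * y i)"

definition width_n :: "nat \<Rightarrow> (nat \<Rightarrow> real) set \<Rightarrow> (nat \<Rightarrow> real) \<Rightarrow> real" where
  "width_n n K U = (SUP t\<in>K. inner_n n U t) - (INF t\<in>K. inner_n n U t)"

definition lebesgue_n :: "nat \<Rightarrow> (nat \<Rightarrow> real) measure" where
  "lebesgue_n n = PiM {..<n} (\<lambda>_. lborel)"

definition unit_ball_n :: "nat \<Rightarrow> (nat \<Rightarrow> real) set" where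
  "unit_ball_n n = {x \<in> PiE {..<n} (\<lambda>_. UNIV). (\<Sum>i<n. (x i)\<^sup>2) \<le> 1}"

text \<open>Uniform (normalized surface) measure on the unit sphere S^{n-1}, defined
  as the cone measure: push-forward of the uniform distribution on the unit
  ball under radial projection x \<mapsto> x / |x|.\<close>
definition sphere_unif :: "nat \<Rightarrow> (nat \<Rightarrow> real) measure" where
  "sphere_unif n = distr (uniform_measure (lebesgue_n n) (unit_ball_n n)) (lebesgue_n n)
     (\<lambda>x. restrict (\<lambda>i. x i / sqrt (\<Sum>j<n. (x j)\<^sup>2)) {..<n})"

definition u_seq :: "nat \<Rightarrow> real" where
  "u_seq n = sqrt (2 * ln (real n))
     - ((1/2) * ln (ln (real n)) + ln (2 * sqrt pi)) / sqrt (2 * ln (real n))"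

end

theory Submission
  imports Defs "HOL-Real_Asymp.Real_Asymp"
begin

text \<open>
  The width of the simplex in direction \<open>U\<close> is \<open>max U\<^sub>i - min U\<^sub>i\<close>, that of the cross-polytope is
  \<open>2 max \<bar>U\<^sub>i\<bar>\<close>, so everything is governed by the probabilities of boxes \<open>-b \<le> \<surd>n U\<^sub>i \<le> a\<close>.
  Writing \<open>exp (-\<bar>x\<bar>\<^sup>2 / 2)\<close> as an integral over the balls containing \<open>x\<close> and using the homogeneity of
  Lebesgue measure on cones shows that \<open>U\<close> has the law of \<open>Z / \<bar>Z\<bar>\<close> for a standard Gaussian \<open>Z\<close>.
  By Chebyshev \<open>\<bar>Z\<bar> / \<surd>n\<close> differs from \<open>1\<close> by at most \<open>n powr (-1/4)\<close> with high probability, which is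
  negligible at the scale of \<open>u\<^sub>n\<close>; hence the box probability is asymptotically that of the independent
  coordinates of \<open>Z\<close>, namely \<open>(1 - Q a - Q b) ^ n\<close> with \<open>Q\<close> the Gaussian tail, and the Mills ratio
  gives its limit. Maximum and minimum are thus asymptotically independent, and joint
  convergence of distribution functions passes to the sum by approximating half planes by staircases.
\<close>

subsection \<open>The Gaussian tail\<close>

definition std_normal :: "real measure" where
  "std_normal = density lborel std_normal_density"

definition normal_tail :: "real \<Rightarrow> real" where
  "normal_tail a = measure std_normal {a<..}"

lemma sets_std_normal [measurable_cong, simp]: "sets std_normal = sets borel"
  by (simp add: std_normal_def)

lemma space_std_normal [simp]: "space std_normal = UNIV"
  by (simp add: std_normal_def)

lemma prob_space_std_normal: "prob_space std_normal"
  unfolding std_normal_def by (rule prob_space_normal_density) simp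

interpretation std_normal: prob_space std_normal
  by (rule prob_space_std_normal)

lemma emeasure_std_normal:
  "A \<in> sets borel \<Longrightarrow>
    emeasure std_normal A = (\<integral>\<^sup>+x. ennreal (std_normal_density x) * indicator A x \<partial>lborel)"
  unfolding std_normal_def by (subst emeasure_density) auto

lemma measure_std_normal_singleton: "measure std_normal {a} = 0"
proof -
  have "emeasure std_normal {a} = 0"
    by (subst emeasure_std_normal) (auto intro!: nn_integral_null_delta[THEN trans] simp: nn_integral_0_iff_AE AE_lborel_singleton)
  then show ?thesis by (simp add: measure_def)
qed

lemma measure_std_normal_reflect:
  assumes [measurable]: "A \<in> sets borel"
  shows "measure std_normal (uminus -` A) = measure std_normal A"
proof -
  have [measurable]: "uminus -` A \<in> sets borel"
    using measurable_sets[of uminus borel borel A] by simp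
  have "emeasure std_normal A = (\<integral>\<^sup>+x. ennreal (std_normal_density x) * indicator A x \<partial>lborel)"
    by (simp add: emeasure_std_normal)
  also have "\<dots> = (\<integral>\<^sup>+x. ennreal (std_normal_density x) * indicator (uminus -` A) x \<partial>lborel)"
    by (subst nn_integral_real_affine[where c="-1" and t=0])
       (auto simp: std_normal_density_def intro!: nn_integral_cong split: split_indicator)
  also have "\<dots> = emeasure std_normal (uminus -` A)"
    by (simp add: emeasure_std_normal)
  finally show ?thesis by (simp add: measure_def)
qed

text \<open>The left tail is a right tail by the symmetry of the density, so one function
  \<open>normal_tail\<close> describes both ends of an interval.\<close>

lemma measure_std_normal_Icc:
  assumes "- b \<le> a"
  shows "measure std_normal {-b..a} = 1 - normal_tail a - normal_tail b"
proof -
  have "measure std_normal {..<-b} = normal_tail b"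
    using measure_std_normal_reflect[of "{b<..}"]
    by (simp add: normal_tail_def vimage_def greaterThan_def less_minus_iff lessThan_def)
  moreover have "measure std_normal ({..<-b} \<union> {-b..a} \<union> {a<..}) = 
    measure std_normal {..<-b} + measure std_normal {-b..a} + measure std_normal {a<..}"
    using assms by (subst std_normal.finite_measure_Union; (subst std_normal.finite_measure_Union)?) auto
  moreover have "{..<-b} \<union> {-b..a} \<union> {a<..} = space std_normal" using assms by auto
  ultimately show ?thesis using std_normal.prob_space by (simp add: normal_tail_def)
qed

text \<open>Integrating \<open>(- \<phi>(x) / x)' = \<phi>(x) (1 + 1 / x\<^sup>2)\<close> over \<open>[a, \<infinity>)\<close> gives both bounds
  on the Mills ratio.\<close>

lemma normal_tail_bounds:
  assumes "a > 0"
  shows "normal_tail a \<le> std_normal_density a / a"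
    and "std_normal_density a / a \<le> (1 + 1 / a\<^sup>2) * normal_tail a"
proof -
  let ?\<phi> = std_normal_density
  \<comment> \<open>The fundamental theorem below integrates over the closed half line; the end
    point is a null set.\<close>
  have atL: "emeasure std_normal {a..} = ennreal (normal_tail a)"
  proof -
    have "measure std_normal ({a} \<union> {a<..}) = measure std_normal {a} + measure std_normal {a<..}"
      by (rule std_normal.finite_measure_Union) auto
    moreover have "{a} \<union> {a<..} = {a..}" by auto
    ultimately show ?thesis
      by (simp add: measure_std_normal_singleton normal_tail_def std_normal.emeasure_eq_measure)
  qed
  have I: "(\<integral>\<^sup>+x. ennreal (?\<phi> x * (1 + 1 / x\<^sup>2)) * indicator {a..} x \<partial>lborel) = ennreal (?\<phi> a / a)"
  proof -
    have "(\<integral>\<^sup>+x. ennreal (?\<phi> x * (1 + 1 / x\<^sup>2)) * indicator {a..} x \<partial>lborel) = ennreal (0 - (- ?\<phi> a / a))"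
    proof (rule nn_integral_FTC_atLeast)
      show "((\<lambda>x. - ?\<phi> x / x) \<longlongrightarrow> 0) at_top"
        unfolding std_normal_density_def by real_asymp
      show "((\<lambda>x. - ?\<phi> x / x) has_real_derivative ?\<phi> x * (1 + 1 / x\<^sup>2)) (at x)" if "a \<le> x" for x
      proof -
        have "((\<lambda>x. - (1 / sqrt (2 * pi)) * (exp (- x\<^sup>2 / 2) / x)) has_real_derivative
            - (1 / sqrt (2 * pi)) * (- (exp (- x\<^sup>2 / 2) * (1 + 1 / x\<^sup>2)))) (at x)"
          using that assms by (intro DERIV_cmult)
            (auto intro!: derivative_eq_intros simp: field_simps power2_eq_square)
        then show ?thesis by (simp add: std_normal_density_def)
      qed
    qed auto
    then show ?thesis by simp
  qed
  \<comment> \<open>Upper bound: the correction \<open>1 / x\<^sup>2\<close> in the integrand is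
    nonnegative.\<close>
  have "ennreal (normal_tail a) = (\<integral>\<^sup>+x. ennreal (?\<phi> x) * indicator {a..} x \<partial>lborel)"
    by (simp add: atL[symmetric] emeasure_std_normal)
  also have "\<dots> \<le> (\<integral>\<^sup>+x. ennreal (?\<phi> x * (1 + 1 / x\<^sup>2)) * indicator {a..} x \<partial>lborel)"
    by (intro nn_integral_mono mult_right_mono ennreal_leI) (auto simp: mult_le_cancel_left1 leD[OF normal_density_nonneg])
  finally show "normal_tail a \<le> ?\<phi> a / a"
    using I assms by simp
  \<comment> \<open>Lower bound: on the domain of integration the correction is largest at the end
    point \<open>a\<close>.\<close>
  have "ennreal (?\<phi> a / a) \<le> (\<integral>\<^sup>+x. ennreal (1 + 1 / a\<^sup>2) * (ennreal (?\<phi> x) * indicator {a..} x) \<partial>lborel)"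
    unfolding I[symmetric] 
  proof (intro nn_integral_mono)
    fix x :: real
    have "?\<phi> x * (1 + 1 / x\<^sup>2) \<le> (1 + 1 / a\<^sup>2) * ?\<phi> x" if "a \<le> x"
    proof -
      have "1 / x\<^sup>2 \<le> 1 / a\<^sup>2" using that assms by (intro divide_left_mono power_mono) auto
      then show ?thesis by (subst mult.commute) (intro mult_right_mono, auto)
    qed
    then show "ennreal (?\<phi> x * (1 + 1 / x\<^sup>2)) * indicator {a..} x \<le> ennreal (1 + 1 / a\<^sup>2) * (ennreal (?\<phi> x) * indicator {a..} x)"
      by (simp add: ennreal_mult'[symmetric] del: ennreal_plus split: split_indicator)
  qed
  also have "\<dots> = ennreal ((1 + 1 / a\<^sup>2) * normal_tail a)"
    by (subst nn_integral_cmult) (auto simp: atL emeasure_std_normal[symmetric] ennreal_mult normal_tail_def)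
  finally show "?\<phi> a / a \<le> (1 + 1 / a\<^sup>2) * normal_tail a"
    by (subst (asm) ennreal_le_iff) (auto simp: normal_tail_def intro!: mult_nonneg_nonneg add_nonneg_nonneg)
qed

text \<open>With \<open>t = sqrt (2 * ln n)\<close> and \<open>s = t * (a - t)\<close> one has
  \<open>a\<^sup>2 / 2 = ln n + s + (s / t)\<^sup>2 / 2\<close>. The hypothesis says
  \<open>s = - c - ln (ln n) / 2 + o(1)\<close>, so \<open>n * exp (- a\<^sup>2 / 2)\<close> behaves
  like \<open>exp c * sqrt (ln n)\<close>. The Mills ratio divides this by
  \<open>sqrt (2 * pi) * a\<close>, which behaves like
  \<open>2 * sqrt pi * sqrt (ln n)\<close>.\<close>

lemma tendsto_normal_tail:
  fixes a :: "nat \<Rightarrow> real" and c :: real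
  assumes lim: "(\<lambda>n. sqrt (2 * ln n) * (a n - sqrt (2 * ln n)) + ln (ln n) / 2) \<longlonglongrightarrow> - c"
  shows "(\<lambda>n. real n * normal_tail (a n)) \<longlonglongrightarrow> exp c / (2 * sqrt pi)"
    and "filterlim a at_top sequentially"
proof -
  define t :: "nat \<Rightarrow> real" where "t n = sqrt (2 * ln n)" for n
  define d where "d n = t n * (a n - t n) + ln (ln n) / 2" for n
  define s where "s n = t n * (a n - t n)" for n
  have d: "d \<longlonglongrightarrow> - c" using lim unfolding d_def[abs_def] t_def .
  have t: "filterlim t at_top sequentially" unfolding t_def by real_asymp
  have ev: "\<forall>\<^sub>F n in sequentially. t n > 0 \<and> n > 2"
    using t eventually_gt_at_top[of 2] by (intro eventually_conj) (auto simp: filterlim_at_top_dense)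
  have s: "s n = d n - ln (ln n) / 2" for n by (simp add: s_def d_def)
  \<comment> \<open>Although \<open>s\<close> itself diverges, it does so only like
    \<open>ln (ln n)\<close>, hence is negligible against \<open>t\<close>.\<close>
  have "(\<lambda>n. d n * (1 / t n) - ln (ln n) / (2 * t n)) \<longlonglongrightarrow> (- c) * 0 - 0"
    by (intro tendsto_intros d; (unfold t_def)?; real_asymp)
  then have st: "(\<lambda>n. s n / t n) \<longlonglongrightarrow> 0" by (simp add: s diff_divide_distrib)
  have "(\<lambda>n. s n / t n * (1 / t n)) \<longlonglongrightarrow> 0 * 0"
    by (intro tendsto_intros st; (unfold t_def)?; real_asymp)
  then have stt: "(\<lambda>n. s n / (t n)\<^sup>2) \<longlonglongrightarrow> 0" by (simp add: power2_eq_square)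
  have a: "a n = t n + s n / t n" if "t n > 0" for n
    using that by (simp add: s_def)
  have "filterlim (\<lambda>n. s n / t n + t n) at_top sequentially"
    by (rule filterlim_tendsto_add_at_top[OF st t])
  moreover have "\<forall>\<^sub>F n in sequentially. s n / t n + t n = a n"
    using ev by eventually_elim (simp add: a)
  ultimately show A: "filterlim a at_top sequentially"
    by (simp cong: filterlim_cong)
  have eva: "\<forall>\<^sub>F n in sequentially. a n > 0"
    using A by (auto simp: filterlim_at_top_dense)
  have "(\<lambda>n. exp (- d n - (s n / t n)\<^sup>2 / 2) / (2 * sqrt pi * (1 + s n / (t n)\<^sup>2)))
      \<longlonglongrightarrow> exp (- (- c) - 0\<^sup>2 / 2) / (2 * sqrt pi * (1 + 0))"
    by (intro tendsto_intros d st stt) auto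
  \<comment> \<open>An exact identity: the factor \<open>sqrt (ln n)\<close> produced by the
    exponent cancels the one contained in \<open>a n\<close>.\<close>
  moreover have "\<forall>\<^sub>F n in sequentially. exp (- d n - (s n / t n)\<^sup>2 / 2) / (2 * sqrt pi * (1 + s n / (t n)\<^sup>2))
      = real n * (std_normal_density (a n) / a n)"
    using ev eva
  proof eventually_elim
    case (elim n)
    have L: "ln (real n) > 0" using elim by simp
    have t2: "(t n)\<^sup>2 = 2 * ln n" using L by (simp add: t_def)
    have e1: "(a n)\<^sup>2 / 2 = ln n + s n + (s n / t n)\<^sup>2 / 2"
      using elim by (simp add: a power2_sum t2)
    have "real n * exp (- (a n)\<^sup>2 / 2) = exp (ln n - (a n)\<^sup>2 / 2)"
      using elim exp_add[of "ln (real n)" "- (a n)\<^sup>2 / 2"] by simp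
    also have "\<dots> = exp (- d n - (s n / t n)\<^sup>2 / 2 + ln (ln n) / 2)"
      unfolding e1 s by (simp add: algebra_simps)
    also have "\<dots> = exp (- d n - (s n / t n)\<^sup>2 / 2) * sqrt (ln n)"
      using L by (simp add: exp_add ln_sqrt[symmetric])
    finally have e2: "real n * exp (- (a n)\<^sup>2 / 2) = exp (- d n - (s n / t n)\<^sup>2 / 2) * sqrt (ln n)" .
    have e3: "a n = t n * (1 + s n / (t n)\<^sup>2)"
      using elim by (simp add: a power2_eq_square field_simps)
    have e4: "sqrt (2 * pi) * a n = 2 * sqrt pi * (1 + s n / (t n)\<^sup>2) * sqrt (ln n)"
    proof -
      have "sqrt (2 * pi) * t n = 2 * sqrt pi * sqrt (ln n)"
        by (simp add: t_def real_sqrt_mult)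
      moreover have "sqrt (2 * pi) * a n = (sqrt (2 * pi) * t n) * (1 + s n / (t n)\<^sup>2)"
        by (subst e3) (simp only: mult.assoc)
      ultimately show ?thesis by (simp only: mult_ac)
    qed
    have "real n * (std_normal_density (a n) / a n) = (real n * exp (- (a n)\<^sup>2 / 2)) / (sqrt (2 * pi) * a n)"
      by (simp add: std_normal_density_def)
    also have "\<dots> = exp (- d n - (s n / t n)\<^sup>2 / 2) / (2 * sqrt pi * (1 + s n / (t n)\<^sup>2))"
      unfolding e2 e4 using L by simp
    finally show ?case by simp
  qed
  ultimately have M: "(\<lambda>n. real n * (std_normal_density (a n) / a n)) \<longlonglongrightarrow> exp c / (2 * sqrt pi)"
    by (simp cong: filterlim_cong)
  \<comment> \<open>The two Mills bounds differ by the factor \<open>1 + 1 / a\<^sup>2\<close>,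
    which tends to 1 because \<open>a\<close> tends to infinity.\<close>
  have "(\<lambda>n. real n * (std_normal_density (a n) / a n) / (1 + inverse (a n) ^ 2)) \<longlonglongrightarrow> exp c / (2 * sqrt pi) / (1 + 0^2)"
    by (intro tendsto_intros M tendsto_inverse_0_at_top[OF A]) auto
  then have M2: "(\<lambda>n. real n * (std_normal_density (a n) / a n) / (1 + inverse (a n) ^ 2)) \<longlonglongrightarrow> exp c / (2 * sqrt pi)"
    by simp
  show "(\<lambda>n. real n * normal_tail (a n)) \<longlonglongrightarrow> exp c / (2 * sqrt pi)"
  proof (rule tendsto_sandwich[OF _ _ M2 M])
    show "\<forall>\<^sub>F n in sequentially. real n * normal_tail (a n) \<le> real n * (std_normal_density (a n) / a n)"
      using eva by eventually_elim (intro mult_left_mono normal_tail_bounds, auto)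
    show "\<forall>\<^sub>F n in sequentially. real n * (std_normal_density (a n) / a n) / (1 + inverse (a n) ^ 2) \<le> real n * normal_tail (a n)"
      using eva
    proof eventually_elim
      case (elim n)
      have p: "0 < 1 + inverse (a n) ^ 2" by (simp add: add_pos_nonneg)
      have "real n * (std_normal_density (a n) / a n) \<le> real n * ((1 + 1 / (a n)\<^sup>2) * normal_tail (a n))"
        using elim by (intro mult_left_mono normal_tail_bounds) auto
      then show ?case using p by (subst pos_divide_le_eq) (auto simp: field_simps)
    qed
  qed
qed

text \<open>Since \<open>q\<close> tends to 0,
  \<open>(1 - q) ^ n = exp (n * q * (ln (1 - q) / q))\<close> eventually, and the last quotient
  tends to -1. No sign of \<open>q\<close> is assumed.\<close>

lemma tendsto_one_minus_power:
  fixes q :: "nat \<Rightarrow> real"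
  assumes "(\<lambda>n. real n * q n) \<longlonglongrightarrow> L"
  shows "(\<lambda>n. (1 - q n) ^ n) \<longlonglongrightarrow> exp (- L)"
proof -
  have "(\<lambda>n. real n * q n * inverse (real n)) \<longlonglongrightarrow> L * 0"
    by (intro tendsto_intros assms lim_inverse_n)
  moreover have "\<forall>\<^sub>F n in sequentially. real n * q n * inverse (real n) = q n"
    using eventually_gt_at_top[of 0] by eventually_elim simp
  ultimately have q0: "q \<longlonglongrightarrow> 0" by (simp cong: filterlim_cong)
  then have evq: "\<forall>\<^sub>F n in sequentially. q n < 1" by (auto intro: order_tendstoD)
  \<comment> \<open>The value -1 at 0 makes \<open>g\<close> continuous there and keeps the
    exponential identity valid for those \<open>n\<close> with \<open>q n = 0\<close>.\<close>
  define g :: "real \<Rightarrow> real" where "g x = (if x = 0 then - 1 else ln (1 - x) / x)" for x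
  have "((\<lambda>x. ln (1 - x) / x) \<longlongrightarrow> - 1) (at (0::real))" by real_asymp
  then have "(g \<longlongrightarrow> - 1) (at 0)"
    by (rule Lim_transform_eventually) (auto simp: g_def eventually_at_filter)
  then have "isCont g 0" by (simp add: isCont_def g_def)
  then have "(\<lambda>n. g (q n)) \<longlonglongrightarrow> g 0" using q0 by (rule isCont_tendsto_compose)
  then have "(\<lambda>n. exp (real n * q n * g (q n))) \<longlonglongrightarrow> exp (L * (- 1))"
    by (intro tendsto_intros assms) (simp add: g_def)
  moreover have "\<forall>\<^sub>F n in sequentially. exp (real n * q n * g (q n)) = (1 - q n) ^ n"
    using evq by eventually_elim (auto simp: g_def exp_of_nat_mult)
  ultimately show ?thesis by (simp cong: filterlim_cong)
qed

subsection \<open>The Gaussian measure and the uniform measure on the sphere\<close>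

definition gauss_n :: "nat \<Rightarrow> (nat \<Rightarrow> real) measure" where
  "gauss_n n = PiM {..<n} (\<lambda>_. std_normal)"

definition sq_norm_n :: "nat \<Rightarrow> (nat \<Rightarrow> real) \<Rightarrow> real" where
  "sq_norm_n n x = (\<Sum>i<n. (x i)\<^sup>2)"

lemma sets_gauss_n [measurable_cong]: "sets (gauss_n n) = sets (lebesgue_n n)"
  unfolding gauss_n_def lebesgue_n_def by (intro sets_PiM_cong) auto

lemma space_gauss_n: "space (gauss_n n) = PiE {..<n} (\<lambda>_. UNIV)"
  by (simp add: gauss_n_def space_PiM)

lemma space_lebesgue_n: "space (lebesgue_n n) = PiE {..<n} (\<lambda>_. UNIV)"
  by (simp add: lebesgue_n_def space_PiM)

lemma measurable_component_lebesgue_n: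
  "i < n \<Longrightarrow> (\<lambda>x. x i) \<in> borel_measurable (lebesgue_n n)"
  unfolding lebesgue_n_def by measurable

lemma measurable_sq_norm_n [measurable]: "sq_norm_n n \<in> borel_measurable (lebesgue_n n)"
  unfolding sq_norm_n_def[abs_def] lebesgue_n_def by measurable

interpretation std_normal_product: product_sigma_finite "\<lambda>_::nat. std_normal"
  by unfold_locales

lemma prob_space_gauss_n: "prob_space (gauss_n n)"
  unfolding gauss_n_def by (intro prob_space_PiM prob_space_std_normal)

section \<open>Moments of the Gaussian measure and concentration of the squared norm\<close>

lemma has_bochner_integral_std_normal:
  assumes "has_bochner_integral lborel (\<lambda>x. std_normal_density x * f x) I"
    and [measurable]: "f \<in> borel_measurable borel"
  shows "has_bochner_integral std_normal f I"
  using assms unfolding std_normal_def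
  by (intro has_bochner_integral_density) auto

lemma std_normal_centred_square_moments:
  shows "has_bochner_integral std_normal (\<lambda>x. x\<^sup>2 - 1) 0"
    and "has_bochner_integral std_normal (\<lambda>x. (x\<^sup>2 - 1)\<^sup>2) 2"
proof -
  have m2: "has_bochner_integral std_normal (\<lambda>x. x\<^sup>2) 1"
    using std_normal_moment_even[of 1] by (intro has_bochner_integral_std_normal) (auto simp: fact_numeral)
  have m4: "has_bochner_integral std_normal (\<lambda>x. x ^ 4) 3"
    using std_normal_moment_even[of 2] by (intro has_bochner_integral_std_normal) (auto simp: fact_numeral)
  have m0: "has_bochner_integral std_normal (\<lambda>x. 1 :: real) 1"
    using std_normal.prob_space by (simp add: has_bochner_integral_iff)
  show "has_bochner_integral std_normal (\<lambda>x. x\<^sup>2 - 1) 0"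
    using has_bochner_integral_diff[OF m2 m0] by simp
  have "has_bochner_integral std_normal (\<lambda>x. x ^ 4 - 2 * x\<^sup>2 + 1) (3 - 2 * 1 + 1)"
    by (intro has_bochner_integral_add has_bochner_integral_diff has_bochner_integral_mult_right m4 m2 m0)
  moreover have "(\<lambda>x. x ^ 4 - 2 * x\<^sup>2 + 1) = (\<lambda>x::real. (x\<^sup>2 - 1)\<^sup>2)"
    by (auto simp: power2_eq_square power4_eq_xxxx algebra_simps)
  ultimately show "has_bochner_integral std_normal (\<lambda>x. (x\<^sup>2 - 1)\<^sup>2) 2"
    by simp
qed

text \<open>Independence of the coordinates: the integrand is a product of functions of one
  coordinate each, so its integral factorises, and off the diagonal a centred factor kills
  it.\<close>

lemma gauss_n_covariance:
  assumes "i < n" "j < n"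
  shows "has_bochner_integral (gauss_n n) (\<lambda>x. ((x i)\<^sup>2 - 1) * ((x j)\<^sup>2 - 1)) (if i = j then 2 else 0)"
proof -
  define w :: "real \<Rightarrow> real" where "w x = x\<^sup>2 - 1" for x
  \<comment> \<open>Padding with the constant 1 in the remaining coordinates turns the integrand
    into a product over all \<open>k < n\<close>.\<close>
  define f where "f k = (if k = i \<and> k = j then (\<lambda>x. w x ^ 2) else if k = i \<or> k = j then w else (\<lambda>x. 1))" for k
  have w: "has_bochner_integral std_normal w 0" "has_bochner_integral std_normal (\<lambda>x. w x ^ 2) 2"
    using std_normal_centred_square_moments by (simp_all add: w_def[abs_def])
  have int: "integrable std_normal (f k)" for k
    using w unfolding f_def has_bochner_integral_iff by auto
  have I: "integral\<^sup>L std_normal (f k) = (if k = i \<and> k = j then 2 else if k = i \<or> k = j then 0 else 1)" for k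
    using w std_normal.prob_space unfolding f_def has_bochner_integral_iff by auto
  have P: "(\<Prod>k<n. f k (x k)) = ((x i)\<^sup>2 - 1) * ((x j)\<^sup>2 - 1)" for x :: "nat \<Rightarrow> real"
  proof (cases "i = j")
    case True
    have "(\<Prod>k<n. f k (x k)) = (\<Prod>k<n. if k = i then w (x i) ^ 2 else 1)"
      using True by (intro prod.cong) (auto simp: f_def)
    then show ?thesis using True assms by (simp add: w_def power2_eq_square)
  next
    case False
    have "(\<Prod>k<n. f k (x k)) = (\<Prod>k<n. (if k = i then w (x i) else 1) * (if k = j then w (x j) else 1))"
      using False by (intro prod.cong) (auto simp: f_def)
    then show ?thesis using assms by (simp add: prod.distrib w_def)
  qed
  have Q: "(\<Prod>k<n. integral\<^sup>L std_normal (f k)) = (if i = j then 2 else 0)"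
  proof (cases "i = j")
    case True
    have "(\<Prod>k<n. integral\<^sup>L std_normal (f k)) = (\<Prod>k<n. if k = i then 2 else 1)"
      using True by (intro prod.cong) (auto simp: I)
    then show ?thesis using True assms by simp
  next
    case False
    then show ?thesis using assms by (auto simp: I intro!: bexI[of _ i])
  qed
  have "integrable (gauss_n n) (\<lambda>x. \<Prod>k<n. f k (x k))"
    unfolding gauss_n_def by (rule std_normal_product.product_integrable_prod) (auto simp: int)
  moreover have "(\<integral>x. (\<Prod>k<n. f k (x k)) \<partial>gauss_n n) = (\<Prod>k<n. integral\<^sup>L std_normal (f k))"
    unfolding gauss_n_def by (rule std_normal_product.product_integral_prod) (auto simp: int)
  ultimately show ?thesis by (simp add: has_bochner_integral_iff P Q)
qed

text \<open>Chebyshev's inequality: expanding the square of the centred sum leaves only the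
  diagonal, so the variance is \<open>2 * n\<close>.\<close>

lemma gauss_n_sq_norm_concentration:
  assumes "r > 0"
  shows "measure (gauss_n n) {x\<in>space (gauss_n n). r \<le> \<bar>sq_norm_n n x - n\<bar>} \<le> 2 * n / r\<^sup>2"
proof -
  interpret prob_space "gauss_n n" by (rule prob_space_gauss_n)
  have "has_bochner_integral (gauss_n n) (\<lambda>x. \<Sum>i<n. \<Sum>j<n. ((x i)\<^sup>2 - 1) * ((x j)\<^sup>2 - 1))
      (\<Sum>i<n. \<Sum>j<n. if i = j then 2 else 0)"
    by (intro has_bochner_integral_sum gauss_n_covariance) auto
  moreover have "(\<Sum>i<n. \<Sum>j<n. ((x i)\<^sup>2 - 1) * ((x j)\<^sup>2 - 1)) = (sq_norm_n n x - n)\<^sup>2" for x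
    by (simp add: sq_norm_n_def power2_eq_square[of "_ - real n"] sum_product[symmetric] sum_subtractf)
  ultimately have H: "has_bochner_integral (gauss_n n) (\<lambda>x. (sq_norm_n n x - n)\<^sup>2) (2 * n)"
    by (simp add: mult.commute)
  have "measure (gauss_n n) {x\<in>space (gauss_n n). (sq_norm_n n x - n)\<^sup>2 \<ge> r\<^sup>2} \<le> (\<integral>x. (sq_norm_n n x - n)\<^sup>2 \<partial>gauss_n n) / r\<^sup>2"
    using H assms by (intro integral_Markov_inequality_measure[where A="{}"]) (auto simp: has_bochner_integral_iff)
  moreover have "r\<^sup>2 \<le> (sq_norm_n n x - n)\<^sup>2 \<longleftrightarrow> r \<le> \<bar>sq_norm_n n x - n\<bar>" for x
    using assms by (metis abs_le_square_iff abs_of_pos)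
  ultimately show ?thesis using H by (simp add: has_bochner_integral_iff)
qed

section \<open>Dilations, radial projection and the Gaussian mass of cones\<close>

definition scale_n :: "nat \<Rightarrow> real \<Rightarrow> (nat \<Rightarrow> real) \<Rightarrow> nat \<Rightarrow> real" where
  "scale_n n r x = restrict (\<lambda>i. r * x i) {..<n}"

text \<open>The map used in \<open>sphere_unif\<close>. As for \<open>scale_n\<close>,
  \<open>restrict\<close> keeps the values among the extensional functions that form
  \<open>space (lebesgue_n n)\<close>.\<close>

definition sphere_proj :: "nat \<Rightarrow> (nat \<Rightarrow> real) \<Rightarrow> nat \<Rightarrow> real" where
  "sphere_proj n x = restrict (\<lambda>i. x i / sqrt (sq_norm_n n x)) {..<n}"

interpretation lborel_product: product_sigma_finite "\<lambda>_::nat. lborel :: real measure"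
  by unfold_locales

lemma sigma_finite_lebesgue_n: "sigma_finite_measure (lebesgue_n n)"
  unfolding lebesgue_n_def by (rule lborel_product.sigma_finite) simp

lemma measurable_scale_n [measurable]: "scale_n n r \<in> measurable (lebesgue_n n) (lebesgue_n n)"
  unfolding scale_n_def[abs_def] lebesgue_n_def by measurable

lemma measurable_sphere_proj [measurable]: "sphere_proj n \<in> measurable (lebesgue_n n) (lebesgue_n n)"
proof -
  have "(\<lambda>x. restrict (\<lambda>i. x i / sqrt (sq_norm_n n x)) {..<n}) \<in> measurable (lebesgue_n n) (PiM {..<n} (\<lambda>_. lborel))"
    by (intro measurable_restrict)
       (auto intro!: borel_measurable_divide measurable_component_lebesgue_n)
  then show ?thesis by (simp add: sphere_proj_def[abs_def] lebesgue_n_def)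
qed

lemma sq_norm_scale_n: "sq_norm_n n (scale_n n r x) = r\<^sup>2 * sq_norm_n n x"
  by (simp add: sq_norm_n_def scale_n_def power_mult_distrib sum_distrib_left)

lemma sq_norm_n_nonneg [simp]: "0 \<le> sq_norm_n n x"
  by (simp add: sq_norm_n_def sum_nonneg)

lemma sphere_proj_scale_n:
  "r > 0 \<Longrightarrow> sphere_proj n (scale_n n r x) = sphere_proj n x"
  by (auto simp: sphere_proj_def sq_norm_scale_n real_sqrt_mult fun_eq_iff restrict_def)
     (auto simp: scale_n_def)

lemma unit_ball_n_eq: "unit_ball_n n = {x\<in>space (lebesgue_n n). sq_norm_n n x \<le> 1}"
  by (simp add: unit_ball_n_def space_lebesgue_n sq_norm_n_def)

text \<open>Homogeneity of degree \<open>n\<close>. Product measures are determined by boxes, and on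
  a box each of the \<open>n\<close> sides contributes one factor \<open>r\<close>.\<close>

lemma lebesgue_n_scale:
  assumes r: "r > 0"
  shows "scale_measure (ennreal (r ^ n)) (distr (lebesgue_n n) (lebesgue_n n) (scale_n n r)) = lebesgue_n n"
proof -
  have "scale_measure (ennreal (r ^ n)) (distr (lebesgue_n n) (lebesgue_n n) (scale_n n r)) = PiM {..<n} (\<lambda>_. lborel)"
  proof (rule lborel_product.PiM_eqI)
    fix A :: "nat \<Rightarrow> real set" assume A: "\<And>i. i \<in> {..<n} \<Longrightarrow> A i \<in> sets lborel"
    have B: "(*) r -` A i \<in> sets borel" if "i < n" for i
      using measurable_sets[of "(*) r" borel borel "A i"] A[of i] that by simp
    have PA: "Pi\<^sub>E {..<n} A \<in> sets (lebesgue_n n)"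
      unfolding lebesgue_n_def using A by (intro sets_PiM_I_finite) auto
    have vim: "scale_n n r -` Pi\<^sub>E {..<n} A \<inter> space (lebesgue_n n) = Pi\<^sub>E {..<n} (\<lambda>i. (*) r -` A i)"
      by (auto simp: scale_n_def space_lebesgue_n PiE_iff)
    have one: "emeasure lborel (A i) = ennreal r * emeasure lborel ((*) r -` A i)" if "i < n" for i
    proof -
      have [measurable]: "A i \<in> sets borel" using A[of i] that by simp
      have "(\<integral>\<^sup>+x. indicator (A i) x \<partial>lborel) = ennreal \<bar>r\<bar> * (\<integral>\<^sup>+x. indicator (A i) (0 + r * x) \<partial>lborel)"
        using r by (intro nn_integral_real_affine) auto
      also have "(\<integral>\<^sup>+x. indicator (A i) (0 + r * x) \<partial>lborel) = (\<integral>\<^sup>+x. indicator ((*) r -` A i) x \<partial>lborel)"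
        by (intro nn_integral_cong) (auto split: split_indicator)
      finally show ?thesis using r B[OF that] by simp
    qed
    have "emeasure (scale_measure (ennreal (r ^ n)) (distr (lebesgue_n n) (lebesgue_n n) (scale_n n r))) (Pi\<^sub>E {..<n} A)
      = ennreal (r ^ n) * emeasure (lebesgue_n n) (Pi\<^sub>E {..<n} (\<lambda>i. (*) r -` A i))"
      using PA by (simp add: emeasure_distr vim)
    also have "emeasure (lebesgue_n n) (Pi\<^sub>E {..<n} (\<lambda>i. (*) r -` A i)) = (\<Prod>i<n. emeasure lborel ((*) r -` A i))"
      unfolding lebesgue_n_def using B by (intro lborel_product.emeasure_PiM) auto
    also have "ennreal (r ^ n) * \<dots> = (\<Prod>i<n. ennreal r * emeasure lborel ((*) r -` A i))"
      using r by (simp add: prod.distrib ennreal_power)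
    also have "\<dots> = (\<Prod>i<n. emeasure lborel (A i))"
      by (intro prod.cong) (auto simp: one)
    finally show "emeasure (scale_measure (ennreal (r ^ n)) (distr (lebesgue_n n) (lebesgue_n n) (scale_n n r))) (Pi\<^sub>E {..<n} A)
      = (\<Prod>i\<in>{..<n}. emeasure lborel (A i))" .
  qed (auto simp: lebesgue_n_def)
  then show ?thesis by (simp add: lebesgue_n_def)
qed

text \<open>The dilation by \<open>r\<close> pulls the ball of radius \<open>r\<close> back to the
  unit ball and leaves \<open>C\<close> in place, so homogeneity gives the factor
  \<open>r ^ n\<close>.\<close>

lemma emeasure_cone_ball:
  assumes [measurable]: "C \<in> sets (lebesgue_n n)" and r: "r > 0"
    and cone: "\<And>x. x \<in> space (lebesgue_n n) \<Longrightarrow> scale_n n r x \<in> C \<longleftrightarrow> x \<in> C"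
  shows "emeasure (lebesgue_n n) {x\<in>C. sq_norm_n n x \<le> r\<^sup>2} = ennreal (r ^ n) * emeasure (lebesgue_n n) (C \<inter> unit_ball_n n)"
proof -
  have Csp: "C \<subseteq> space (lebesgue_n n)" using assms(1) by (rule sets.sets_into_space)
  have "{x\<in>C. sq_norm_n n x \<le> r\<^sup>2} = C \<inter> {x\<in>space (lebesgue_n n). sq_norm_n n x \<le> r\<^sup>2}" using Csp by auto
  then have [measurable]: "{x\<in>C. sq_norm_n n x \<le> r\<^sup>2} \<in> sets (lebesgue_n n)" by simp
  have "emeasure (lebesgue_n n) {x\<in>C. sq_norm_n n x \<le> r\<^sup>2} = 
    ennreal (r ^ n) * emeasure (lebesgue_n n) (scale_n n r -` {x\<in>C. sq_norm_n n x \<le> r\<^sup>2} \<inter> space (lebesgue_n n))"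
    by (subst lebesgue_n_scale[OF r, of n, symmetric])
       (simp add: emeasure_distr)
  also have "scale_n n r -` {x\<in>C. sq_norm_n n x \<le> r\<^sup>2} \<inter> space (lebesgue_n n) = C \<inter> unit_ball_n n"
    using r cone Csp by (auto simp: unit_ball_n_eq sq_norm_scale_n)
  finally show ?thesis .
qed

text \<open>The product of the one-dimensional densities depends on \<open>x\<close> through its
  norm alone; this rotational symmetry is what the cone computation exploits.\<close>

lemma gauss_n_density:
  "gauss_n n = density (lebesgue_n n) (\<lambda>x. ennreal ((1 / sqrt (2 * pi)) ^ n * exp (- sq_norm_n n x / 2)))"
proof -
  have prod: "(\<Prod>i<n. ennreal (std_normal_density (x i))) = ennreal ((1 / sqrt (2 * pi)) ^ n * exp (- sq_norm_n n x / 2))" for x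
  proof -
    have "(\<Prod>i<n. ennreal (std_normal_density (x i))) = ennreal (\<Prod>i<n. std_normal_density (x i))"
      by (rule prod_ennreal) simp
    also have "(\<Prod>i<n. std_normal_density (x i)) = (1 / sqrt (2 * pi)) ^ n * exp (\<Sum>i<n. - (x i)\<^sup>2 / 2)"
      unfolding std_normal_density_def by (subst prod.distrib, subst exp_sum) auto
    also have "(\<Sum>i<n. - (x i)\<^sup>2 / 2) = - sq_norm_n n x / 2"
      by (simp add: sq_norm_n_def sum_negf sum_divide_distrib)
    finally show ?thesis .
  qed
  have "density (lebesgue_n n) (\<lambda>x. ennreal ((1 / sqrt (2 * pi)) ^ n * exp (- sq_norm_n n x / 2))) = PiM {..<n} (\<lambda>_. std_normal)"
  proof (rule std_normal_product.PiM_eqI)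
    fix A :: "nat \<Rightarrow> real set" assume A: "\<And>i. i \<in> {..<n} \<Longrightarrow> A i \<in> sets std_normal"
    have PA: "Pi\<^sub>E {..<n} A \<in> sets (lebesgue_n n)"
      unfolding lebesgue_n_def using A by (intro sets_PiM_I_finite) auto
    have "emeasure (density (lebesgue_n n) (\<lambda>x. ennreal ((1 / sqrt (2 * pi)) ^ n * exp (- sq_norm_n n x / 2)))) (Pi\<^sub>E {..<n} A)
      = (\<integral>\<^sup>+x. (\<Prod>i<n. ennreal (std_normal_density (x i))) * indicator (Pi\<^sub>E {..<n} A) x \<partial>lebesgue_n n)"
      using PA by (subst emeasure_density) (auto simp: prod)
    \<comment> \<open>The indicator of a box factorises over the coordinates, which makes the
      integral a product of one-dimensional ones.\<close>
    also have "\<dots> = (\<integral>\<^sup>+x. (\<Prod>i<n. ennreal (std_normal_density (x i)) * indicator (A i) (x i)) \<partial>lebesgue_n n)"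
    proof (intro nn_integral_cong)
      fix x assume "x \<in> space (lebesgue_n n)"
      then have "indicator (Pi\<^sub>E {..<n} A) x = (\<Prod>i<n. indicator (A i) (x i) :: ennreal)"
        by (cases "x \<in> Pi\<^sub>E {..<n} A") (auto simp: space_lebesgue_n PiE_iff intro!: bexI[rotated])
      then show "(\<Prod>i<n. ennreal (std_normal_density (x i))) * indicator (Pi\<^sub>E {..<n} A) x
          = (\<Prod>i<n. ennreal (std_normal_density (x i)) * indicator (A i) (x i))"
        by (simp add: prod.distrib)
    qed
    also have "\<dots> = (\<Prod>i<n. \<integral>\<^sup>+x. ennreal (std_normal_density x) * indicator (A i) x \<partial>lborel)"
      unfolding lebesgue_n_def using A by (intro lborel_product.product_nn_integral_prod) auto
    also have "\<dots> = (\<Prod>i<n. emeasure std_normal (A i))"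
      using A by (intro prod.cong) (auto simp: emeasure_std_normal)
    finally show "emeasure (density (lebesgue_n n) (\<lambda>x. ennreal ((1 / sqrt (2 * pi)) ^ n * exp (- sq_norm_n n x / 2)))) (Pi\<^sub>E {..<n} A)
      = (\<Prod>i\<in>{..<n}. emeasure std_normal (A i))" .
  qed (auto simp: sets_gauss_n[symmetric] gauss_n_def)
  then show ?thesis by (simp add: gauss_n_def)
qed

text \<open>Applied with \<open>a\<close> the norm of \<open>x\<close>, the range
  \<open>{a..}\<close> consists of the radii of the centred closed balls that contain
  \<open>x\<close>.\<close>

lemma exp_neg_half_square_layer_cake:
  fixes a :: real
  assumes "a \<ge> 0"
  shows "ennreal (exp (- a\<^sup>2 / 2)) = (\<integral>\<^sup>+r. ennreal (r * exp (- r\<^sup>2 / 2)) * indicator {a..} r \<partial>lborel)"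
proof -
  have "(\<integral>\<^sup>+r. ennreal (r * exp (- r\<^sup>2 / 2)) * indicator {a..} r \<partial>lborel) = ennreal (0 - (- exp (- a\<^sup>2 / 2)))"
  proof (rule nn_integral_FTC_atLeast)
    show "((\<lambda>x::real. - exp (- x\<^sup>2 / 2)) \<longlongrightarrow> 0) at_top" by real_asymp
  qed (use assms in \<open>auto intro!: derivative_eq_intros\<close>)
  then show ?thesis by simp
qed

text \<open>The radial factor of the Gaussian mass of a cone. Its value is never computed: total
  mass one forces it to be the reciprocal of the volume of the unit ball.\<close>

definition gauss_radial_const :: "nat \<Rightarrow> ennreal" where
  "gauss_radial_const n = ennreal ((1 / sqrt (2 * pi)) ^ n) *
     (\<integral>\<^sup>+r. ennreal (r * exp (- r\<^sup>2 / 2)) * ennreal (r ^ n) * indicator {0<..} r \<partial>lborel)"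

text \<open>After the layer-cake formula and an exchange of integrals, the inner integral is the
  volume of \<open>C\<close> inside a ball of radius \<open>r\<close>. By homogeneity its dependence
  on \<open>C\<close> separates from that on \<open>r\<close>.\<close>

lemma gauss_n_cone:
  assumes C[measurable]: "C \<in> sets (lebesgue_n n)"
    and cone: "\<And>r x. r > 0 \<Longrightarrow> x \<in> space (lebesgue_n n) \<Longrightarrow> scale_n n r x \<in> C \<longleftrightarrow> x \<in> C"
  shows "emeasure (gauss_n n) C = gauss_radial_const n * emeasure (lebesgue_n n) (C \<inter> unit_ball_n n)"
proof -
  define c where "c = ennreal ((1 / sqrt (2 * pi)) ^ n)"
  define g where "g r = ennreal (r * exp (- r\<^sup>2 / 2))" for r
  have [measurable]: "g \<in> borel_measurable borel" unfolding g_def by measurable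
  interpret L: sigma_finite_measure "lebesgue_n n" by (rule sigma_finite_lebesgue_n)
  interpret P: pair_sigma_finite "lebesgue_n n" "lborel :: real measure" ..
  have Csp: "C \<subseteq> space (lebesgue_n n)" using C by (rule sets.sets_into_space)
  have "emeasure (gauss_n n) C = (\<integral>\<^sup>+x. c * (ennreal (exp (- sq_norm_n n x / 2)) * indicator C x) \<partial>lebesgue_n n)"
    unfolding gauss_n_density c_def by (subst emeasure_density) (auto simp: ennreal_mult mult.assoc)
  also have "\<dots> = c * (\<integral>\<^sup>+x. ennreal (exp (- sq_norm_n n x / 2)) * indicator C x \<partial>lebesgue_n n)"
    by (rule nn_integral_cmult) measurable
  also have "(\<integral>\<^sup>+x. ennreal (exp (- sq_norm_n n x / 2)) * indicator C x \<partial>lebesgue_n n)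
    = (\<integral>\<^sup>+x. \<integral>\<^sup>+r. g r * indicator {sqrt (sq_norm_n n x)..} r * indicator C x \<partial>lborel \<partial>lebesgue_n n)"
  proof (intro nn_integral_cong)
    fix x assume "x \<in> space (lebesgue_n n)"
    show "ennreal (exp (- sq_norm_n n x / 2)) * indicator C x = (\<integral>\<^sup>+r. g r * indicator {sqrt (sq_norm_n n x)..} r * indicator C x \<partial>lborel)"
      using exp_neg_half_square_layer_cake[of "sqrt (sq_norm_n n x)"]
      by (subst nn_integral_multc) (auto simp: g_def)
  qed
  \<comment> \<open>Written as a condition on the pair \<open>(x, r)\<close>, the indicator is
    visibly jointly measurable, as Fubini requires.\<close>
  also have "\<dots> = (\<integral>\<^sup>+x. \<integral>\<^sup>+r. g r * (if sqrt (sq_norm_n n x) \<le> r then 1 else 0) * indicator C x \<partial>lborel \<partial>lebesgue_n n)"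
    by (intro nn_integral_cong) (auto split: split_indicator)
  also have "\<dots> = (\<integral>\<^sup>+r. \<integral>\<^sup>+x. g r * (if sqrt (sq_norm_n n x) \<le> r then 1 else 0) * indicator C x \<partial>lebesgue_n n \<partial>lborel)"
    by (rule P.Fubini'[symmetric]) measurable
  also have "\<dots> = (\<integral>\<^sup>+r. (g r * ennreal (r ^ n) * indicator {0<..} r) * emeasure (lebesgue_n n) (C \<inter> unit_ball_n n) \<partial>lborel)"
  proof (intro nn_integral_cong)
    fix r :: real
    show "(\<integral>\<^sup>+x. g r * (if sqrt (sq_norm_n n x) \<le> r then 1 else 0) * indicator C x \<partial>lebesgue_n n)
      = (g r * ennreal (r ^ n) * indicator {0<..} r) * emeasure (lebesgue_n n) (C \<inter> unit_ball_n n)"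
    proof (cases "r > 0")
      case True
      have le: "sqrt (sq_norm_n n x) \<le> r \<longleftrightarrow> sq_norm_n n x \<le> r\<^sup>2" for x
        using True by (metis less_imp_le real_sqrt_abs abs_of_pos real_sqrt_le_iff)
      have "{x\<in>C. sq_norm_n n x \<le> r\<^sup>2} = C \<inter> {x\<in>space (lebesgue_n n). sq_norm_n n x \<le> r\<^sup>2}" using Csp by auto
      then have [measurable]: "{x\<in>C. sq_norm_n n x \<le> r\<^sup>2} \<in> sets (lebesgue_n n)" by simp
      have "(\<integral>\<^sup>+x. g r * (if sqrt (sq_norm_n n x) \<le> r then 1 else 0) * indicator C x \<partial>lebesgue_n n)
        = (\<integral>\<^sup>+x. g r * indicator {x\<in>C. sq_norm_n n x \<le> r\<^sup>2} x \<partial>lebesgue_n n)"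
        by (intro nn_integral_cong) (auto simp: le split: split_indicator)
      also have "\<dots> = g r * emeasure (lebesgue_n n) {x\<in>C. sq_norm_n n x \<le> r\<^sup>2}"
        by (rule nn_integral_cmult_indicator) measurable
      also have "\<dots> = g r * (ennreal (r ^ n) * emeasure (lebesgue_n n) (C \<inter> unit_ball_n n))"
        using True by (subst emeasure_cone_ball) (auto simp: cone)
      finally show ?thesis using True by (simp add: mult.assoc)
    next
      case False
      \<comment> \<open>\<open>ennreal\<close> truncates negative numbers to 0, so negative radii
        contribute nothing.\<close>
      then have "g r = 0" by (auto simp: g_def intro!: ennreal_neg mult_nonpos_nonneg)
      then show ?thesis by simp
    qed
  qed
  also have "\<dots> = (\<integral>\<^sup>+r. g r * ennreal (r ^ n) * indicator {0<..} r \<partial>lborel) * emeasure (lebesgue_n n) (C \<inter> unit_ball_n n)"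
    by (rule nn_integral_multc) measurable
  finally show ?thesis by (simp add: gauss_radial_const_def c_def g_def mult.assoc)
qed

section \<open>The uniform law on the sphere as a projected Gaussian\<close>

lemma sphere_unif_eq_uniform_measure:
  "sphere_unif n = distr (uniform_measure (lebesgue_n n) (unit_ball_n n)) (lebesgue_n n) (sphere_proj n)"
  by (simp add: sphere_unif_def sphere_proj_def[abs_def] sq_norm_n_def)

text \<open>The preimage of a set under the radial projection is a cone, and on cones both the
  Gaussian and the uniform measure on the ball are proportional to the volume inside the unit
  ball.\<close>

lemma sphere_unif_eq_gauss: "sphere_unif n = distr (gauss_n n) (lebesgue_n n) (sphere_proj n)"
proof -
  define K where "K = gauss_radial_const n"
  interpret prob_space "gauss_n n" by (rule prob_space_gauss_n)
  define B where "B = unit_ball_n n"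
  have B[measurable]: "B \<in> sets (lebesgue_n n)" unfolding B_def unit_ball_n_eq by measurable
  have sc: "scale_n n r x \<in> space (lebesgue_n n)" for r x
    by (auto simp: scale_n_def space_lebesgue_n)
  have spG: "space (gauss_n n) = space (lebesgue_n n)" by (simp add: space_gauss_n space_lebesgue_n)
  \<comment> \<open>The whole space is itself a cone, of Gaussian mass one; this fixes the
    constant.\<close>
  have "K * emeasure (lebesgue_n n) (space (lebesgue_n n) \<inter> B) = 1"
    using gauss_n_cone[of "space (lebesgue_n n)" n] emeasure_space_1 by (simp add: sc spG B_def K_def)
  then have KB: "K * emeasure (lebesgue_n n) B = 1"
    using sets.sets_into_space[OF B] by (simp add: Int_absorb1)
  have B0: "emeasure (lebesgue_n n) B \<noteq> 0" using KB by auto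
  have Btop: "emeasure (lebesgue_n n) B \<noteq> top" using KB by (auto simp: ennreal_mult_eq_top_iff ennreal_mult_top split: if_splits)
  show ?thesis
  proof (rule measure_eqI)
    show "sets (sphere_unif n) = sets (distr (gauss_n n) (lebesgue_n n) (sphere_proj n))"
      by (simp add: sphere_unif_def)
    fix A assume "A \<in> sets (sphere_unif n)"
    then have A[measurable]: "A \<in> sets (lebesgue_n n)" by (simp add: sphere_unif_def)
    define C where "C = sphere_proj n -` A \<inter> space (lebesgue_n n)"
    have C[measurable]: "C \<in> sets (lebesgue_n n)" unfolding C_def by measurable
    have "emeasure (distr (gauss_n n) (lebesgue_n n) (sphere_proj n)) A = emeasure (gauss_n n) C"
      by (subst emeasure_distr) (auto simp: C_def spG)
    also have "\<dots> = K * emeasure (lebesgue_n n) (C \<inter> B)"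
      unfolding B_def K_def by (rule gauss_n_cone[OF C]) (auto simp: C_def sc sphere_proj_scale_n)
    also have "\<dots> = K * emeasure (lebesgue_n n) B * emeasure (lebesgue_n n) (C \<inter> B) / emeasure (lebesgue_n n) B"
      using ennreal_mult_divide_eq[OF B0 Btop, of "K * emeasure (lebesgue_n n) (C \<inter> B)"]
      by (simp add: mult_ac)
    also have "\<dots> = emeasure (uniform_measure (lebesgue_n n) B) C"
      by (subst emeasure_uniform_measure) (auto simp: KB Int_commute)
    also have "\<dots> = emeasure (sphere_unif n) A"
      unfolding sphere_unif_eq_uniform_measure B_def[symmetric]
      by (subst emeasure_distr) (auto simp: C_def)
    finally show "emeasure (sphere_unif n) A = emeasure (distr (gauss_n n) (lebesgue_n n) (sphere_proj n)) A" ..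
  qed
qed

subsection \<open>Box probabilities\<close>

lemma measure_gauss_n_box:
  assumes "- b \<le> a"
  shows "measure (gauss_n n) {x\<in>space (gauss_n n). \<forall>i<n. - b \<le> x i \<and> x i \<le> a} = (1 - (normal_tail a + normal_tail b)) ^ n"
proof -
  have "{x\<in>space (gauss_n n). \<forall>i<n. - b \<le> x i \<and> x i \<le> a} = Pi\<^sub>E {..<n} (\<lambda>_. {-b..a})"
    by (intro set_eqI) (simp add: space_gauss_n PiE_iff Ball_def conj_commute)
  then have "emeasure (gauss_n n) {x\<in>space (gauss_n n). \<forall>i<n. - b \<le> x i \<and> x i \<le> a} = (\<Prod>i<n. emeasure std_normal {-b..a})"
    unfolding gauss_n_def by (simp only:) (intro std_normal_product.emeasure_PiM, auto)
  also have "\<dots> = ennreal (measure std_normal {-b..a} ^ n)"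
    by (simp add: std_normal.emeasure_eq_measure ennreal_power)
  finally show ?thesis
    by (simp add: measure_def[of "gauss_n n"] measure_std_normal_Icc[OF assms, symmetric] diff_diff_eq[symmetric])
qed

lemma measurable_box_lebesgue_n:
  "{x\<in>space (lebesgue_n n). \<forall>i<n. - b \<le> x i \<and> x i \<le> a} \<in> sets (lebesgue_n n)"
proof -
  have "{x\<in>space (lebesgue_n n). \<forall>i<n. - b \<le> x i \<and> x i \<le> a} = Pi\<^sub>E {..<n} (\<lambda>_. {-b..a})"
    by (intro set_eqI) (simp add: space_lebesgue_n PiE_iff Ball_def conj_commute)
  also have "\<dots> \<in> sets (lebesgue_n n)"
    unfolding lebesgue_n_def by (intro sets_PiM_I_finite) auto
  finally show ?thesis .
qed

lemma abs_sqrt_minus_one_le: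
  fixes q :: real
  assumes "0 \<le> q" shows "\<bar>sqrt q - 1\<bar> \<le> \<bar>q - 1\<bar>"
proof -
  have "\<bar>q - 1\<bar> = \<bar>sqrt q - 1\<bar> * (sqrt q + 1)"
  proof -
    have "q - 1 = (sqrt q - 1) * (sqrt q + 1)" using assms by (simp add: algebra_simps)
    moreover have "\<bar>sqrt q + 1\<bar> = sqrt q + 1" using assms by simp
    ultimately show ?thesis by (simp only: abs_mult)
  qed
  then show ?thesis using assms by (simp add: mult_le_cancel_left1)
qed

text \<open>Outside the exceptional event \<open>N\<close> the ratio of the Gaussian norm to
  \<open>sqrt n\<close> lies between \<open>1 - e\<close> and \<open>1 + e\<close>. There the box
  event for \<open>U\<close> is enclosed between Gaussian boxes with sides scaled by these factors;
  the signs of \<open>a\<close> and \<open>b\<close> make the scaling monotone.\<close>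

lemma sphere_unif_box_bounds:
  fixes a b e :: real
  assumes n: "n > 0" and ab: "0 \<le> a" "0 \<le> b" and e: "0 < e" "e < 1"
  defines "p \<equiv> \<lambda>s. (1 - (normal_tail (a * s) + normal_tail (b * s))) ^ n"
    and "P \<equiv> measure (sphere_unif n) {U\<in>space (lebesgue_n n). \<forall>i<n. - (b / sqrt n) \<le> U i \<and> U i \<le> a / sqrt n}"
  shows "p (1 - e) - 2 / (n * e\<^sup>2) \<le> P" "P \<le> p (1 + e) + 2 / (n * e\<^sup>2)"
proof -
  interpret prob_space "gauss_n n" by (rule prob_space_gauss_n)
  have sp: "space (gauss_n n) = space (lebesgue_n n)" by (simp add: space_gauss_n space_lebesgue_n)
  define S where "S = {x\<in>space (gauss_n n). \<forall>i<n. - (b / sqrt n) \<le> sphere_proj n x i \<and> sphere_proj n x i \<le> a / sqrt n}"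
  define E where "E s = {x\<in>space (gauss_n n). \<forall>i<n. - (b * s) \<le> x i \<and> x i \<le> a * s}" for s
  define N where "N = {x\<in>space (gauss_n n). e * n \<le> \<bar>sq_norm_n n x - n\<bar>}"
  have [measurable]: "N \<in> sets (lebesgue_n n)" unfolding N_def sp by measurable
  have [measurable]: "E s \<in> sets (lebesgue_n n)" for s
    unfolding E_def sp by (rule measurable_box_lebesgue_n)
  have S_eq: "S = sphere_proj n -` {U\<in>space (lebesgue_n n). \<forall>i<n. - (b / sqrt n) \<le> U i \<and> U i \<le> a / sqrt n} \<inter> space (gauss_n n)"
    using measurable_space[OF measurable_sphere_proj[of n]] by (auto simp: S_def sp)
  have S_meas [measurable]: "S \<in> sets (lebesgue_n n)"
    unfolding S_eq sp by (rule measurable_sets[OF measurable_sphere_proj measurable_box_lebesgue_n])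
  have P: "P = prob S"
    unfolding P_def sphere_unif_eq_gauss S_eq
    by (rule measure_distr[OF _ measurable_box_lebesgue_n]) measurable
  have pE: "prob (E s) = p s" if "s \<ge> 0" for s
    unfolding E_def p_def using ab that
    by (intro measure_gauss_n_box) (meson mult_nonneg_nonneg neg_le_0_iff_le order_trans)
  \<comment> \<open>Chebyshev with deviation \<open>r = e * n\<close> around the mean
    \<open>n\<close>.\<close>
  have N: "prob N \<le> 2 / (n * e\<^sup>2)"
    using gauss_n_sq_norm_concentration[of "e * n" n] n e
    by (simp add: N_def power_mult_distrib field_simps power2_eq_square)
  have good: "0 < sqrt (sq_norm_n n x)" "sqrt (sq_norm_n n x) \<le> sqrt n * (1 + e)" "sqrt n * (1 - e) \<le> sqrt (sq_norm_n n x)"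
    if "x \<in> space (gauss_n n) - N" for x
  proof -
    define q where "q = sq_norm_n n x / n"
    have "\<bar>sq_norm_n n x - n\<bar> < e * n" using that by (auto simp: N_def)
    moreover have "sq_norm_n n x - n = (q - 1) * n"
      using n by (simp add: q_def field_simps)
    then have "\<bar>sq_norm_n n x - n\<bar> = \<bar>q - 1\<bar> * n"
      by (simp add: abs_mult)
    ultimately have "\<bar>q - 1\<bar> < e" using n by simp
    moreover have "0 \<le> q" by (simp add: q_def)
    ultimately have "\<bar>sqrt q - 1\<bar> < e" using abs_sqrt_minus_one_le[of q] by linarith
    then have sq: "1 - e < sqrt q" "sqrt q < 1 + e" by linarith+
    have eq: "sqrt (sq_norm_n n x) = sqrt n * sqrt q"
      using n by (simp add: q_def real_sqrt_mult[symmetric])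
    show "sqrt (sq_norm_n n x) \<le> sqrt n * (1 + e)" "sqrt n * (1 - e) \<le> sqrt (sq_norm_n n x)"
      unfolding eq using sq by (auto intro!: mult_left_mono)
    have "0 < sqrt n * (1 - e)" using n e by simp
    then show "0 < sqrt (sq_norm_n n x)" using \<open>sqrt n * (1 - e) \<le> _\<close> by linarith
  qed
  have iff: "y / sqrt (sq_norm_n n x) \<le> c / sqrt n \<longleftrightarrow> y \<le> c * (sqrt (sq_norm_n n x) / sqrt n)"
    if "x \<in> space (gauss_n n) - N" for x c and y :: real
    using good(1)[OF that] n by (simp add: field_simps)
  have ratio: "1 - e \<le> sqrt (sq_norm_n n x) / sqrt n" "sqrt (sq_norm_n n x) / sqrt n \<le> 1 + e"
    if "x \<in> space (gauss_n n) - N" for x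
    using good[OF that] n by (simp_all add: field_simps)
  have S_iff: "x \<in> S \<longleftrightarrow> (\<forall>i<n. - x i \<le> b * (sqrt (sq_norm_n n x) / sqrt n) \<and> x i \<le> a * (sqrt (sq_norm_n n x) / sqrt n))"
    if "x \<in> space (gauss_n n) - N" for x
    using that iff[OF that, of _ a] iff[OF that, of "- _" b]
    by (auto simp: S_def sphere_proj_def minus_le_iff[of "b / _"])
  have sub1: "S \<subseteq> E (1 + e) \<union> N"
  proof
    fix x assume x: "x \<in> S"
    show "x \<in> E (1 + e) \<union> N"
    proof (cases "x \<in> N")
      case False
      then have g: "x \<in> space (gauss_n n) - N" using x by (simp add: S_def)
      have "a * (sqrt (sq_norm_n n x) / sqrt n) \<le> a * (1 + e)" "b * (sqrt (sq_norm_n n x) / sqrt n) \<le> b * (1 + e)"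
        using mult_left_mono[OF ratio(2)[OF g] ab(1)] mult_left_mono[OF ratio(2)[OF g] ab(2)] by simp_all
      then show ?thesis using x S_iff[OF g] g by (fastforce simp: E_def)
    qed simp
  qed
  have sub2: "E (1 - e) \<subseteq> S \<union> N"
  proof
    fix x assume x: "x \<in> E (1 - e)"
    show "x \<in> S \<union> N"
    proof (cases "x \<in> N")
      case False
      then have g: "x \<in> space (gauss_n n) - N" using x by (simp add: E_def)
      have "a * (1 - e) \<le> a * (sqrt (sq_norm_n n x) / sqrt n)" "b * (1 - e) \<le> b * (sqrt (sq_norm_n n x) / sqrt n)"
        using mult_left_mono[OF ratio(1)[OF g] ab(1)] mult_left_mono[OF ratio(1)[OF g] ab(2)] by simp_all
      then show ?thesis using x unfolding Un_iff S_iff[OF g] by (fastforce simp: E_def)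
    qed simp
  qed
  have "prob S \<le> prob (E (1 + e) \<union> N)" using sub1 by (rule finite_measure_mono) measurable
  also have "\<dots> \<le> prob (E (1 + e)) + prob N" by (rule measure_Un_le) measurable
  finally show "P \<le> p (1 + e) + 2 / (n * e\<^sup>2)" using N pE[of "1 + e"] e P by simp
  have "prob (E (1 - e)) \<le> prob (S \<union> N)" using sub2 by (rule finite_measure_mono) measurable
  also have "\<dots> \<le> prob S + prob N" by (rule measure_Un_le) measurable
  finally show "p (1 - e) - 2 / (n * e\<^sup>2) \<le> P" using N pE[of "1 - e"] e P by simp
qed

text \<open>\<open>gumbel_level a c\<close> says that \<open>a\<^sub>n\<close> is a level at which the Gaussian tail is asymptotically
  \<open>e\<^sup>c / (2 \<surd>\<pi> n)\<close>.\<close>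

definition gumbel_level :: "(nat \<Rightarrow> real) \<Rightarrow> real \<Rightarrow> bool" where
  "gumbel_level a c \<longleftrightarrow>
     (\<lambda>n. sqrt (2 * ln n) * (a n - sqrt (2 * ln n)) + ln (ln n) / 2) \<longlonglongrightarrow> - c"

text \<open>Multiplying by \<open>1 + e\<close> changes the defining expression by
  \<open>e * t * a\<close> with \<open>t = sqrt (2 * ln n)\<close>. Since \<open>t * a\<close> is of
  order \<open>ln n\<close>, the hypothesis on \<open>e\<close> makes this vanish.\<close>

lemma gumbel_level_rescale:
  assumes a: "gumbel_level a c" and e: "(\<lambda>n. e n * ln (real n)) \<longlonglongrightarrow> 0"
  shows "gumbel_level (\<lambda>n. a n * (1 + e n)) c"
proof -
  define d where "d n = sqrt (2 * ln n) * (a n - sqrt (2 * ln n)) + ln (ln n) / 2" for n :: nat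
  have d: "d \<longlonglongrightarrow> - c" using a unfolding gumbel_level_def d_def[abs_def] .
  have inv: "(\<lambda>n. inverse (ln (real n))) \<longlonglongrightarrow> 0" by real_asymp
  have lnln: "(\<lambda>n. ln (ln (real n)) / ln (real n)) \<longlonglongrightarrow> 0" by real_asymp
  have "(\<lambda>n. d n + (e n * ln (real n)) * (2 + (d n * inverse (ln n) - (ln (ln n) / ln n) / 2))) \<longlonglongrightarrow> - c + 0 * (2 + (- c * 0 - 0 / 2))"
    by (intro tendsto_intros d e inv lnln) auto
  moreover have "\<forall>\<^sub>F n in sequentially. d n + (e n * ln (real n)) * (2 + (d n * inverse (ln n) - (ln (ln n) / ln n) / 2))
      = sqrt (2 * ln n) * (a n * (1 + e n) - sqrt (2 * ln n)) + ln (ln n) / 2"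
    using eventually_gt_at_top[of 1]
  proof eventually_elim
    case (elim n)
    have L: "ln (real n) > 0" using elim by simp
    define t where "t = sqrt (2 * ln (real n))"
    have t2: "t * t = 2 * ln n" using L by (simp add: t_def)
    have "e n * ln n * (2 + (d n * inverse (ln n) - (ln (ln n) / ln n) / 2)) = e n * (2 * ln n + (d n - ln (ln n) / 2))"
      using L by (simp add: field_simps)
    also have "d n - ln (ln n) / 2 = t * a n - 2 * ln n"
      using t2 by (simp add: d_def t_def[symmetric] algebra_simps)
    finally show ?case
      by (simp add: d_def t_def[symmetric] algebra_simps)
  qed
  ultimately show ?thesis
    unfolding gumbel_level_def by (simp cong: filterlim_cong)
qed

lemma sphere_unif_box_tendsto:
  assumes a: "gumbel_level a c" and b: "gumbel_level b d"
  shows "(\<lambda>n. measure (sphere_unif n) {U\<in>space (lebesgue_n n). \<forall>i<n. - (b n / sqrt n) \<le> U i \<and> U i \<le> a n / sqrt n})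
    \<longlonglongrightarrow> exp (- (exp c / (2 * sqrt pi) + exp d / (2 * sqrt pi)))" (is "?P \<longlonglongrightarrow> ?L")
proof -
  \<comment> \<open>Small enough that \<open>e * ln n\<close> tends to 0, large enough that
    \<open>n * e\<^sup>2 = sqrt n\<close> tends to infinity, so both errors vanish.\<close>
  define e :: "nat \<Rightarrow> real" where "e n = real n powr (-1/4)" for n
  define p where "p n s = (1 - (normal_tail (a n * s) + normal_tail (b n * s))) ^ n" for n s
  \<comment> \<open>The perturbation may have either sign, so this covers both the inner and the
    outer box.\<close>
  have lim: "(\<lambda>n. p n (1 + \<sigma> n)) \<longlonglongrightarrow> ?L" if "(\<lambda>n. \<sigma> n * ln (real n)) \<longlonglongrightarrow> 0" for \<sigma>
  proof -
    have "(\<lambda>n. real n * normal_tail (a n * (1 + \<sigma> n)) + real n * normal_tail (b n * (1 + \<sigma> n)))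
        \<longlonglongrightarrow> exp c / (2 * sqrt pi) + exp d / (2 * sqrt pi)"
      using gumbel_level_rescale[OF a that] gumbel_level_rescale[OF b that]
      unfolding gumbel_level_def by (intro tendsto_add tendsto_normal_tail(1))
    then show ?thesis
      unfolding p_def by (intro tendsto_one_minus_power) (simp add: distrib_left)
  qed
  have err: "(\<lambda>n. 2 / (n * (e n)\<^sup>2)) \<longlonglongrightarrow> 0" unfolding e_def by real_asymp
  have "(\<lambda>n. e n * ln (real n)) \<longlonglongrightarrow> 0" unfolding e_def by real_asymp
  then have up: "(\<lambda>n. p n (1 + e n) + 2 / (n * (e n)\<^sup>2)) \<longlonglongrightarrow> ?L"
    using tendsto_add[OF lim err, of e] by simp
  have "(\<lambda>n. - e n * ln (real n)) \<longlonglongrightarrow> 0" unfolding e_def by real_asymp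
  then have lo: "(\<lambda>n. p n (1 - e n) - 2 / (n * (e n)\<^sup>2)) \<longlonglongrightarrow> ?L"
    using tendsto_diff[OF lim err, of "\<lambda>n. - e n"] by simp
  have pos: "\<forall>\<^sub>F n in sequentially. 0 \<le> f n" if "gumbel_level f c" for f c
    using tendsto_normal_tail(2)[OF that[unfolded gumbel_level_def]] by (auto simp: filterlim_at_top)
  have ev: "\<forall>\<^sub>F n in sequentially. 0 \<le> a n \<and> 0 \<le> b n \<and> 0 < e n \<and> e n < 1 \<and> 0 < n"
    using pos[OF a] pos[OF b] eventually_gt_at_top[of 1]
    by eventually_elim (auto simp: e_def powr_less_one)
  show ?thesis
  proof (rule tendsto_sandwich[OF _ _ lo up])
    show "\<forall>\<^sub>F n in sequentially. p n (1 - e n) - 2 / (n * (e n)\<^sup>2) \<le> ?P n"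
      using ev
    proof eventually_elim
      case (elim n)
      then show ?case using sphere_unif_box_bounds(1)[of n "a n" "b n" "e n"] by (simp add: p_def)
    qed
    show "\<forall>\<^sub>F n in sequentially. ?P n \<le> p n (1 + e n) + 2 / (n * (e n)\<^sup>2)"
      using ev
    proof eventually_elim
      case (elim n)
      then show ?case using sphere_unif_box_bounds(2)[of n "a n" "b n" "e n"] by (simp add: p_def)
    qed
  qed
qed

text \<open>The constant in \<open>u_seq\<close> is chosen so that
  \<open>exp c / (2 * sqrt pi)\<close> becomes \<open>exp (- x)\<close>. The defining expression is
  constant as soon as \<open>n > 1\<close>.\<close>

lemma gumbel_level_u_seq:
  "gumbel_level (\<lambda>n. u_seq n + x / sqrt (2 * ln n)) (ln (2 * sqrt pi) - x)"
proof -
  have "\<forall>\<^sub>F n in sequentially. x - ln (2 * sqrt pi) = 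
      sqrt (2 * ln n) * (u_seq n + x / sqrt (2 * ln n) - sqrt (2 * ln n)) + ln (ln n) / 2"
    using eventually_gt_at_top[of 1]
  proof eventually_elim
    case (elim n)
    have L: "sqrt (2 * ln (real n)) > 0" using elim by simp
    then show ?case by (simp add: u_seq_def field_simps)
  qed
  then show ?thesis
    unfolding gumbel_level_def minus_diff_eq by (rule tendsto_eventually[OF eventually_mono]) simp
qed

text \<open>Centring at \<open>2 * n\<close> while scaling with \<open>n\<close> shifts the level by
  \<open>ln 2\<close>, which halves the tail to \<open>exp (- x) / 2\<close>; the two tails of a
  symmetric box then add up to \<open>exp (- x)\<close>.\<close>

lemma gumbel_level_u_seq_double:
  "gumbel_level (\<lambda>n. u_seq (2 * n) + x / sqrt (2 * ln n)) (ln (2 * sqrt pi) - ln 2 - x)"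
proof -
  define t :: "nat \<Rightarrow> real" where "t n = sqrt (2 * ln n)" for n
  define v :: "nat \<Rightarrow> real" where "v n = sqrt (2 * ln (2 * real n))" for n
  have "(\<lambda>n. v n / t n) \<longlonglongrightarrow> 1" unfolding t_def v_def by real_asymp
  \<comment> \<open>From \<open>v\<^sup>2 - t\<^sup>2 = 2 * ln 2\<close> the difference of squares
    gives \<open>t * (v - t) = 2 * ln 2 / (1 + v / t)\<close>, whose limit is the shift
    \<open>ln 2\<close>.\<close>
  then have "(\<lambda>n. 2 * ln 2 / (1 + v n / t n)) \<longlonglongrightarrow> 2 * ln 2 / (1 + 1)" by (intro tendsto_intros) auto
  moreover have "\<forall>\<^sub>F n in sequentially. 2 * ln 2 / (1 + v n / t n) = t n * v n - (t n)\<^sup>2"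
    using eventually_gt_at_top[of 1]
  proof eventually_elim
    case (elim n)
    have L: "t n > 0" "v n > 0" using elim by (simp_all add: t_def v_def)
    have "(v n)\<^sup>2 - (t n)\<^sup>2 = 2 * ln 2" using elim by (simp add: t_def v_def ln_mult)
    then have e: "2 * ln 2 = (v n - t n) * (v n + t n)" by (simp add: power2_eq_square algebra_simps)
    have "1 + v n / t n = (v n + t n) / t n" using L by (simp add: field_simps)
    then have "2 * ln 2 / (1 + v n / t n) = (v n - t n) * t n" using L unfolding e by simp
    then show ?case by (simp add: power2_eq_square algebra_simps)
  qed
  ultimately have l1: "(\<lambda>n. t n * v n - (t n)\<^sup>2) \<longlonglongrightarrow> ln 2"
    by (simp cong: filterlim_cong)
  have l2: "(\<lambda>n. ln (ln n) / 2 - t n / v n * (ln (ln (2 * real n)) / 2)) \<longlonglongrightarrow> 0" unfolding t_def v_def by real_asymp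
  have l3: "(\<lambda>n. t n / v n) \<longlonglongrightarrow> 1" unfolding t_def v_def by real_asymp
  have "(\<lambda>n. (t n * v n - (t n)\<^sup>2) + (ln (ln n) / 2 - t n / v n * (ln (ln (2 * real n)) / 2)) - t n / v n * ln (2 * sqrt pi) + x)
    \<longlonglongrightarrow> ln 2 + 0 - 1 * ln (2 * sqrt pi) + x"
    by (intro tendsto_intros l1 l2 l3)
  moreover have "\<forall>\<^sub>F n in sequentially. (t n * v n - (t n)\<^sup>2) + (ln (ln n) / 2 - t n / v n * (ln (ln (2 * real n)) / 2)) - t n / v n * ln (2 * sqrt pi) + x
     = sqrt (2 * ln n) * (u_seq (2 * n) + x / sqrt (2 * ln n) - sqrt (2 * ln n)) + ln (ln n) / 2"
    using eventually_gt_at_top[of 1]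
  proof eventually_elim
    case (elim n)
    have L: "t n > 0" "v n > 0" using elim by (simp_all add: t_def v_def)
    have "sqrt (2 * ln n) * (u_seq (2 * n) + x / sqrt (2 * ln n) - sqrt (2 * ln n))
      = t n * (v n - (ln (ln (2 * real n)) / 2 + ln (2 * sqrt pi)) / v n + x / t n - t n)"
      by (simp add: u_seq_def t_def v_def)
    also have "\<dots> = t n * v n - (t n)\<^sup>2 - t n / v n * (ln (ln (2 * real n)) / 2) - t n / v n * ln (2 * sqrt pi) + x"
      using L by (simp add: field_simps power2_eq_square)
    finally show ?case by simp
  qed
  ultimately have "(\<lambda>n. sqrt (2 * ln n) * (u_seq (2 * n) + x / sqrt (2 * ln n) - sqrt (2 * ln n)) + ln (ln n) / 2)
      \<longlonglongrightarrow> ln 2 + 0 - 1 * ln (2 * sqrt pi) + x"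
    by (rule Lim_transform_eventually)
  then show ?thesis unfolding gumbel_level_def by (simp add: algebra_simps)
qed

subsection \<open>Sums of asymptotically independent variables\<close>

text \<open>The mass that a law with joint distribution function \<open>H\<close> gives to the staircase
  \<open>\<Union>\<^sub>k (t\<^sub>k, t\<^sub>k\<^sub>+\<^sub>1] \<times> (-\<infinity>, z - t\<^sub>k]\<close> with \<open>t\<^sub>k = -m + k / m\<close>, which lies between the half planes
  \<open>x + y \<le> z\<close> (restricted to \<open>-m < x \<le> m\<close>) and \<open>x + y \<le> z + 1 / m\<close>.\<close>

definition grid_sum :: "(real \<Rightarrow> real \<Rightarrow> real) \<Rightarrow> nat \<Rightarrow> real \<Rightarrow> real" where
  "grid_sum H m z = (\<Sum>k<2 * m * m. H (-real m + real (Suc k) / m) (z - (-real m + real k / m))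
      - H (-real m + real k / m) (z - (-real m + real k / m)))"

text \<open>The cells of the staircase are disjoint, so \<open>grid_sum\<close> is the probability
  of their union. A cell overshoots the half plane by at most its width \<open>1 / m\<close>, and
  what the cells miss lies outside the window \<open>B\<close>.\<close>

lemma (in prob_space) grid_sum_bounds:
  fixes X Y :: "'a \<Rightarrow> real"
  assumes [measurable]: "X \<in> borel_measurable M" "Y \<in> borel_measurable M" and m: "m > 0"
  defines "H \<equiv> \<lambda>x y. \<P>(\<omega> in M. X \<omega> \<le> x \<and> Y \<omega> \<le> y)"
  shows "grid_sum H m z \<le> \<P>(\<omega> in M. X \<omega> + Y \<omega> \<le> z + 1 / m)"
    and "\<P>(\<omega> in M. X \<omega> + Y \<omega> \<le> z) \<le> grid_sum H m z + (1 - H m m + H (-real m) m)"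
proof -
  define t where "t k = -real m + real k / m" for k
  define A where "A k = {\<omega>\<in>space M. t k < X \<omega> \<and> X \<omega> \<le> t (Suc k) \<and> Y \<omega> \<le> z - t k}" for k
  have A[measurable]: "A k \<in> events" for k unfolding A_def by measurable
  have tmono: "t k \<le> t l" if "k \<le> l" for k l
    using that m by (simp add: t_def divide_right_mono)
  have tS: "t (Suc k) = t k + 1 / m" for k by (simp add: t_def add_divide_distrib)
  have dA: "prob (A k) = H (t (Suc k)) (z - t k) - H (t k) (z - t k)" for k
  proof -
    have "A k = {\<omega>\<in>space M. X \<omega> \<le> t (Suc k) \<and> Y \<omega> \<le> z - t k} - {\<omega>\<in>space M. X \<omega> \<le> t k \<and> Y \<omega> \<le> z - t k}"
      by (auto simp: A_def)
    also have "prob \<dots> = H (t (Suc k)) (z - t k) - H (t k) (z - t k)"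
      unfolding H_def using tmono[of k "Suc k"] by (intro finite_measure_Diff) auto
    finally show ?thesis .
  qed
  have disj: "disjoint_family_on A {..<2 * m * m}"
  proof -
    have "A k \<inter> A l = {}" if "k < l" for k l
      using tmono[of "Suc k" l] that by (auto simp: A_def)
    then show ?thesis unfolding disjoint_family_on_def by (metis Int_commute nat_neq_iff)
  qed
  have G: "grid_sum H m z = prob (\<Union>k<2 * m * m. A k)"
    by (subst finite_measure_finite_Union[OF _ _ disj]) (auto simp: grid_sum_def dA t_def)
  show "grid_sum H m z \<le> \<P>(\<omega> in M. X \<omega> + Y \<omega> \<le> z + 1 / m)"
    unfolding G by (rule finite_measure_mono) (auto simp: A_def tS)
  define B where "B = {\<omega>\<in>space M. X \<omega> \<le> m \<and> Y \<omega> \<le> m} - {\<omega>\<in>space M. X \<omega> \<le> -real m \<and> Y \<omega> \<le> m}"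
  have [measurable]: "B \<in> events" unfolding B_def by measurable
  have B: "prob B = H m m - H (-real m) m"
    unfolding B_def H_def by (intro finite_measure_Diff) auto
  have "{\<omega>\<in>space M. X \<omega> + Y \<omega> \<le> z} \<subseteq> (\<Union>k<2 * m * m. A k) \<union> (space M - B)"
  proof
    fix \<omega> assume w: "\<omega> \<in> {\<omega>\<in>space M. X \<omega> + Y \<omega> \<le> z}"
    show "\<omega> \<in> (\<Union>k<2 * m * m. A k) \<union> (space M - B)"
    proof (cases "\<omega> \<in> B")
      case True
      then have b: "- real m < X \<omega>" "X \<omega> \<le> m" by (auto simp: B_def)
      have "\<exists>k<2 * m * m. t k < X \<omega> \<and> X \<omega> \<le> t (Suc k)"
      proof -
        have t0: "t 0 < X \<omega>" using b by (simp add: t_def)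
        have tn: "X \<omega> \<le> t (2 * m * m)" using b m by (simp add: t_def)
        \<comment> \<open>The first grid point not below \<open>X \<omega>\<close> closes its cell;
          it is not the initial one because \<open>t 0 = - m\<close> lies strictly below
          \<open>X \<omega>\<close>.\<close>
        define l where "l = (LEAST l. X \<omega> \<le> t l)"
        have l1: "X \<omega> \<le> t l" unfolding l_def using tn by (rule LeastI)
        have l2: "l \<le> 2 * m * m" unfolding l_def using tn by (rule Least_le)
        have "l \<noteq> 0" using t0 l1 by (metis not_less)
        then obtain k where k: "l = Suc k" by (cases l) auto
        have "\<not> X \<omega> \<le> t k" using not_less_Least[of k "\<lambda>l. X \<omega> \<le> t l"] k by (simp add: l_def)
        then show ?thesis using l1 l2 k by (intro exI[of _ k]) auto
      qed
      then show ?thesis using w by (force simp: A_def)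
    qed (use w in auto)
  qed
  then have "\<P>(\<omega> in M. X \<omega> + Y \<omega> \<le> z) \<le> prob ((\<Union>k<2 * m * m. A k) \<union> (space M - B))"
    by (rule finite_measure_mono) measurable
  also have "\<dots> \<le> prob (\<Union>k<2 * m * m. A k) + prob (space M - B)"
    by (rule measure_Un_le) measurable
  also have "prob (space M - B) = 1 - prob B" by (rule prob_compl) measurable
  finally show "\<P>(\<omega> in M. X \<omega> + Y \<omega> \<le> z) \<le> grid_sum H m z + (1 - H m m + H (-real m) m)"
    using B G by simp
qed

text \<open>For fixed \<open>m\<close> the staircase involves finitely many values of the joint
  distribution function, so its mass converges as \<open>n\<close> grows. Refining the staircase
  afterwards squeezes the limit at a continuity point of the convolution.\<close>

lemma weak_conv_m_add_convolution:
  fixes M :: "nat \<Rightarrow> 'a measure" and X Y :: "nat \<Rightarrow> 'a \<Rightarrow> real" and G :: "real measure"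
  assumes G: "real_distribution G"
    and M: "\<forall>\<^sub>F n in sequentially. prob_space (M n)"
    and X: "\<forall>\<^sub>F n in sequentially. X n \<in> borel_measurable (M n)"
    and Y: "\<forall>\<^sub>F n in sequentially. Y n \<in> borel_measurable (M n)"
    and lim: "\<And>x y. (\<lambda>n. measure (M n) {\<omega>\<in>space (M n). X n \<omega> \<le> x \<and> Y n \<omega> \<le> y}) \<longlonglongrightarrow> cdf G x * cdf G y"
  shows "weak_conv_m (\<lambda>n. distr (M n) borel (\<lambda>\<omega>. X n \<omega> + Y n \<omega>)) (G \<star> G)"
proof -
  interpret G: real_distribution G by fact
  interpret GG: pair_prob_space G G ..
  define H where "H n = (\<lambda>x y. measure (M n) {\<omega>\<in>space (M n). X n \<omega> \<le> x \<and> Y n \<omega> \<le> y})" for n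
  define c where "c n z = measure (M n) {\<omega>\<in>space (M n). X n \<omega> + Y n \<omega> \<le> z}" for n z
  define K where "K = (\<lambda>x y. cdf G x * cdf G y)"
  define C where "C = cdf (G \<star> G)"
  \<comment> \<open>Bounds the mass missed outside the window; for the limit law it vanishes as
    \<open>m\<close> grows.\<close>
  define \<tau> where "\<tau> K m = 1 - K (real m) (real m) + K (-real m) (real m)" for K :: "real \<Rightarrow> real \<Rightarrow> real" and m :: nat
  \<comment> \<open>The limit is itself a joint distribution function, that of two independent
    copies, so the staircase bounds apply to it as well.\<close>
  have K: "K x y = measure (G \<Otimes>\<^sub>M G) {\<omega>\<in>space (G \<Otimes>\<^sub>M G). fst \<omega> \<le> x \<and> snd \<omega> \<le> y}" for x y
  proof -
    have "{\<omega>\<in>space (G \<Otimes>\<^sub>M G). fst \<omega> \<le> x \<and> snd \<omega> \<le> y} = {..x} \<times> {..y}"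
      by (auto simp: space_pair_measure)
    then show ?thesis by (simp add: K_def cdf_def measure_def G.emeasure_pair_measure_Times enn2real_mult)
  qed
  have C: "C z = measure (G \<Otimes>\<^sub>M G) {\<omega>\<in>space (G \<Otimes>\<^sub>M G). fst \<omega> + snd \<omega> \<le> z}" for z
    unfolding C_def cdf_def convolution_def
    by (subst measure_distr) (auto intro!: arg_cong2[where f=measure] simp: space_pair_measure)
  have limG: "(\<lambda>n. grid_sum (H n) m z) \<longlonglongrightarrow> grid_sum K m z" for m z
    unfolding grid_sum_def K_def H_def by (intro tendsto_intros lim)
  have limT: "(\<lambda>n. \<tau> (H n) m) \<longlonglongrightarrow> \<tau> K m" for m
    unfolding \<tau>_def K_def H_def by (intro tendsto_intros lim)
  have \<tau>0: "(\<lambda>m. \<tau> K m) \<longlonglongrightarrow> 0"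
  proof -
    have "((\<lambda>m. cdf G (real m)) \<longlongrightarrow> 1) sequentially"
      by (rule filterlim_compose[OF G.cdf_lim_at_top_prob filterlim_real_sequentially])
    moreover have "((\<lambda>m. cdf G (- real m)) \<longlongrightarrow> 0) sequentially"
      by (rule filterlim_compose[OF G.cdf_lim_at_bot]) (auto simp: filterlim_uminus_at_bot filterlim_real_sequentially)
    ultimately have "(\<lambda>m. \<tau> K m) \<longlonglongrightarrow> 1 - 1 * 1 + 0 * 1"
      unfolding \<tau>_def K_def by (intro tendsto_intros)
    then show ?thesis by simp
  qed
  have gK1: "grid_sum K m z \<le> C (z + 1 / m)" if "m > 0" for m z
    using GG.grid_sum_bounds(1)[of fst snd m z] that unfolding K[abs_def] C by simp
  have gK2: "C z \<le> grid_sum K m z + \<tau> K m" if "m > 0" for m z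
    using GG.grid_sum_bounds(2)[of fst snd m z] that unfolding K[abs_def] C \<tau>_def by simp
  \<comment> \<open>The lower staircase starts from \<open>z - 1 / m\<close>, so that its overshoot
    ends exactly at \<open>z\<close>.\<close>
  have ev: "\<forall>\<^sub>F n in sequentially. grid_sum (H n) m (z - 1 / m) \<le> c n z \<and> c n z \<le> grid_sum (H n) m z + \<tau> (H n) m"
    if "m > 0" for m z
    using M X Y
  proof eventually_elim
    case (elim n)
    interpret prob_space "M n" by fact
    show ?case
      using grid_sum_bounds(1)[of "X n" "Y n" m "z - 1 / m"] grid_sum_bounds(2)[of "X n" "Y n" m z] elim that
      by (simp add: H_def c_def \<tau>_def)
  qed
  show ?thesis
    unfolding weak_conv_m_def weak_conv_def
  proof (intro allI impI)
    fix z assume "isCont (cdf (G \<star> G)) z"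
    then have cont: "isCont C z" by (simp add: C_def)
    have up: "(\<lambda>m. C (z + 1 / real m) + \<tau> K m) \<longlonglongrightarrow> C (z + 0) + 0"
      by (intro tendsto_intros \<tau>0 isCont_tendsto_compose[of "z + 0" C]) (use cont in \<open>auto simp: lim_1_over_n\<close>)
    have lo: "(\<lambda>m. C (z - 1 / real m) - \<tau> K m) \<longlonglongrightarrow> C (z - 0) - 0"
      by (intro tendsto_intros \<tau>0 isCont_tendsto_compose[of "z - 0" C]) (use cont in \<open>auto simp: lim_1_over_n\<close>)
    have "(\<lambda>n. c n z) \<longlonglongrightarrow> C z"
    proof (rule order_tendstoI)
      fix y assume "y < C z"
      then have "\<forall>\<^sub>F m in sequentially. y < C (z - 1 / real m) - \<tau> K m \<and> m > 0"
        using order_tendstoD(1)[OF lo, of y] eventually_gt_at_top[of 0] by (simp add: eventually_conj_iff)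
      then obtain m where m: "y < C (z - 1 / real m) - \<tau> K m" "m > 0"
        by (auto dest: eventually_happens)
      then have "y < grid_sum K m (z - 1 / m)" using gK2[of m "z - 1 / m"] by simp
      from order_tendstoD(1)[OF limG this] ev[OF m(2), of z]
      show "\<forall>\<^sub>F n in sequentially. y < c n z" by eventually_elim simp
    next
      fix y assume "C z < y"
      then have "\<forall>\<^sub>F m in sequentially. C (z + 1 / real m) + \<tau> K m < y \<and> m > 0"
        using order_tendstoD(2)[OF up, of y] eventually_gt_at_top[of 0] by (simp add: eventually_conj_iff)
      then obtain m where m: "C (z + 1 / real m) + \<tau> K m < y" "m > 0"
        by (auto dest: eventually_happens)
      then have "grid_sum K m z + \<tau> K m < y" using gK1[of m z] by simp
      from order_tendstoD(2)[OF tendsto_add[OF limG limT] this] ev[OF m(2), of z]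
      show "\<forall>\<^sub>F n in sequentially. c n z < y" by eventually_elim simp
    qed
    moreover have "\<forall>\<^sub>F n in sequentially. c n z = cdf (distr (M n) borel (\<lambda>\<omega>. X n \<omega> + Y n \<omega>)) z"
      using X Y
    proof eventually_elim
      case (elim n)
      note [measurable] = elim
      show ?case unfolding c_def cdf_def
        by (subst measure_distr) (auto intro!: arg_cong2[where f=measure])
    qed
    ultimately show "(\<lambda>n. cdf (distr (M n) borel (\<lambda>\<omega>. X n \<omega> + Y n \<omega>)) z) \<longlonglongrightarrow> cdf (G \<star> G) z"
      unfolding C_def by (simp cong: filterlim_cong)
  qed
qed

subsection \<open>Widths\<close>

lemma inner_n_convex_combination:
  "inner_n n U (\<lambda>j. \<Sum>v\<in>F. a v * v j) = (\<Sum>v\<in>F. a v * inner_n n U v)"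
proof -
  have "inner_n n U (\<lambda>j. \<Sum>v\<in>F. a v * v j) = (\<Sum>i<n. \<Sum>v\<in>F. a v * (U i * v i))"
    by (simp add: inner_n_def sum_distrib_left mult_ac)
  also have "\<dots> = (\<Sum>v\<in>F. \<Sum>i<n. a v * (U i * v i))" by (rule sum.swap)
  finally show ?thesis by (simp add: inner_n_def sum_distrib_left)
qed

text \<open>A linear functional takes on a convex combination a weighted average of its values at
  the generators, so its extremes over the hull are attained there.\<close>

lemma width_n_conv_fin:
  assumes V: "finite V" "V \<noteq> {}"
  shows "width_n n (conv_fin V) U = Max (inner_n n U ` V) - Min (inner_n n U ` V)"
proof -
  have sub: "v \<in> conv_fin V" if "v \<in> V" for v
    unfolding conv_fin_def using that by (auto intro!: exI[of _ "{v}"] exI[of _ "\<lambda>_. 1"])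
  have bounds: "Min (inner_n n U ` V) \<le> inner_n n U t \<and> inner_n n U t \<le> Max (inner_n n U ` V)" if mem: "t \<in> conv_fin V" for t
  proof -
    obtain F a where F: "finite F" "F \<subseteq> V" "\<forall>v\<in>F. a v \<ge> 0" "sum a F = 1" and t: "t = (\<lambda>j. \<Sum>v\<in>F. a v * v j)"
      using mem unfolding conv_fin_def by blast
    have "(\<Sum>v\<in>F. a v * inner_n n U v) \<le> (\<Sum>v\<in>F. a v * Max (inner_n n U ` V))"
      using F V by (intro sum_mono mult_left_mono) auto
    moreover have "(\<Sum>v\<in>F. a v * Min (inner_n n U ` V)) \<le> (\<Sum>v\<in>F. a v * inner_n n U v)"
      using F V by (intro sum_mono mult_left_mono) auto
    ultimately show ?thesis
      using F by (simp add: t inner_n_convex_combination sum_distrib_right[symmetric])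
  qed
  have "Max (inner_n n U ` V) \<in> inner_n n U ` V" "Min (inner_n n U ` V) \<in> inner_n n U ` V"
    using V by (auto intro!: Max_in Min_in)
  then have "Max (inner_n n U ` V) \<in> inner_n n U ` conv_fin V" "Min (inner_n n U ` V) \<in> inner_n n U ` conv_fin V"
    using sub by auto
  then have "(SUP t\<in>conv_fin V. inner_n n U t) = Max (inner_n n U ` V)"
    "(INF t\<in>conv_fin V. inner_n n U t) = Min (inner_n n U ` V)"
    using bounds by (auto intro!: cSup_eq_maximum cInf_eq_minimum)
  then show ?thesis by (simp add: width_n_def)
qed

lemma inner_n_std_basis:
  assumes "i < n"
  shows "inner_n n U (\<lambda>j. s * std_basis i j) = s * U i"
proof -
  have "inner_n n U (\<lambda>j. s * std_basis i j) = (\<Sum>j<n. if j = i then s * U i else 0)"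
    unfolding inner_n_def std_basis_def by (intro sum.cong) auto
  then show ?thesis using assms by simp
qed

lemma width_simplex_n:
  assumes "n > 0"
  shows "width_n n (simplex_n n) U = Max (U ` {..<n}) - Min (U ` {..<n})"
proof -
  have "inner_n n U ` std_basis ` {..<n} = U ` {..<n}"
    unfolding image_image using inner_n_std_basis[of _ n U 1] by (intro image_cong) auto
  then show ?thesis
    unfolding simplex_n_def using assms by (subst width_n_conv_fin) auto
qed

text \<open>The values at the vertices are the numbers \<open>U i\<close> and their negatives, a
  symmetric set, so its minimum is minus its maximum.\<close>

lemma width_crosspoly_n:
  assumes "n > 0"
  shows "width_n n (crosspoly_n n) U = 2 * Max ((\<lambda>i. \<bar>U i\<bar>) ` {..<n})"
proof -
  define W where "W = (\<lambda>(s, i). s * U i) ` ({1, -1} \<times> {..<n})"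
  define m where "m = Max ((\<lambda>i. \<bar>U i\<bar>) ` {..<n})"
  have W: "inner_n n U ` (\<lambda>(s, i). (\<lambda>j. s * std_basis i j)) ` ({1, -1} \<times> {..<n}) = W"
    unfolding W_def image_image by (intro image_cong) (auto simp: inner_n_std_basis[of _ n U "- 1", simplified] inner_n_std_basis[of _ n U 1, simplified])
  have le: "\<bar>U i\<bar> \<le> m" if "i < n" for i
    unfolding m_def using that by (intro Max_ge) auto
  have "m \<in> (\<lambda>i. \<bar>U i\<bar>) ` {..<n}"
    unfolding m_def using assms by (intro Max_in) auto
  then obtain k where k: "k < n" "m = \<bar>U k\<bar>" by auto
  have W_eq: "W = U ` {..<n} \<union> (\<lambda>i. - U i) ` {..<n}"
    unfolding W_def by force
  have fin: "finite W" by (simp add: W_eq)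
  have "m \<in> W" "- m \<in> W"
    using k by (auto simp: W_eq abs_if)
  moreover have "w \<le> m \<and> - m \<le> w" if "w \<in> W" for w
    using that le by (force simp: W_eq)
  ultimately have "Max W = m" "Min W = - m"
    using fin by (auto intro!: Max_eqI Min_eqI)
  then show ?thesis
    unfolding crosspoly_n_def using assms by (subst width_n_conv_fin) (auto simp: W m_def)
qed

section \<open>The random widths: measurability and limit laws\<close>

lemma prob_space_sphere_unif: "prob_space (sphere_unif n)"
  unfolding sphere_unif_eq_gauss
  by (rule prob_space.prob_space_distr[OF prob_space_gauss_n]) measurable

lemma sets_sphere_unif [measurable_cong]: "sets (sphere_unif n) = sets (lebesgue_n n)"
  by (simp add: sphere_unif_def)

lemma space_sphere_unif: "space (sphere_unif n) = space (lebesgue_n n)"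
  by (simp add: sphere_unif_def)

lemma measurable_component_sphere_unif:
  "i < n \<Longrightarrow> (\<lambda>U. U i) \<in> borel_measurable (sphere_unif n)"
  using measurable_component_lebesgue_n[of i n] measurable_cong_sets[OF sets_sphere_unif refl] by blast

lemma measurable_Max_sphere_unif:
  "(\<lambda>U. Max (U ` {..<n})) \<in> borel_measurable (sphere_unif n)"
  using borel_measurable_Max[of "{..<n}" "\<lambda>i U. U i" "sphere_unif n"] by (simp add: measurable_component_sphere_unif)

lemma measurable_Min_sphere_unif:
  "(\<lambda>U. Min (U ` {..<n})) \<in> borel_measurable (sphere_unif n)"
  using borel_measurable_Min[of "{..<n}" "\<lambda>i U. U i" "sphere_unif n"] by (simp add: measurable_component_sphere_unif)

lemma measurable_Max_abs_sphere_unif: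
  "(\<lambda>U. Max ((\<lambda>i. \<bar>U i\<bar>) ` {..<n})) \<in> borel_measurable (sphere_unif n)"
  using borel_measurable_Max[of "{..<n}" "\<lambda>i U. \<bar>U i\<bar>" "sphere_unif n"]
  by (simp add: measurable_component_sphere_unif borel_measurable_abs)

text \<open>Turns the normalised inequality into the threshold form of the box probabilities;
  \<open>n > 1\<close> makes \<open>ln n\<close> positive.\<close>

lemma rescaled_le_iff:
  fixes w u x :: real
  assumes "n > 1"
  shows "sqrt (2 * real n * ln n) * (w - u / sqrt n) \<le> x \<longleftrightarrow> w \<le> (u + x / sqrt (2 * ln n)) / sqrt n"
proof -
  define r t where "r = sqrt (real n)" and "t = sqrt (2 * ln (real n))"
  have pos: "r > 0" "t > 0" using assms by (auto simp: r_def t_def)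
  have "sqrt (2 * real n * ln n) = r * t" by (simp add: r_def t_def real_sqrt_mult)
  moreover have "r * t * (w - u / r) \<le> x \<longleftrightarrow> w \<le> (u + x / t) / r"
  proof -
    have "r * t * (w - u / r) = (r * w - u) * t" using pos by (simp add: field_simps)
    then have "r * t * (w - u / r) \<le> x \<longleftrightarrow> r * w - u \<le> x / t"
      using pos by (simp only: pos_le_divide_eq)
    also have "\<dots> \<longleftrightarrow> w * r \<le> u + x / t" by (auto simp: algebra_simps)
    also have "\<dots> \<longleftrightarrow> w \<le> (u + x / t) / r" using pos by (simp only: pos_le_divide_eq)
    finally show ?thesis .
  qed
  ultimately show ?thesis by (simp add: r_def t_def)
qed

text \<open>The width splits into the maximum and minus the minimum, each centred at
  \<open>u_seq n / sqrt n\<close>. Their joint distribution function is a box probability, whose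
  limit is a product.\<close>

lemma simplex_width_weak_conv:
  assumes G: "real_distribution G" and cdf: "\<And>x. cdf G x = exp (- exp (- x))"
  shows "weak_conv_m
           (\<lambda>n. distr (sphere_unif n) borel
              (\<lambda>U. sqrt (2 * real n * ln (real n)) *
                   (width_n n (simplex_n n) U - 2 * u_seq n / sqrt (real n))))
           (G \<star> G)"
proof -
  define X where "X n U = sqrt (2 * real n * ln n) * (Max (U ` {..<n}) - u_seq n / sqrt n)" for n and U :: "nat \<Rightarrow> real"
  define Y where "Y n U = sqrt (2 * real n * ln n) * (- Min (U ` {..<n}) - u_seq n / sqrt n)" for n and U :: "nat \<Rightarrow> real"
  \<comment> \<open>Holds for every \<open>n\<close>: at 0 the prefactor vanishes on both
    sides.\<close>
  have XY: "sqrt (2 * real n * ln (real n)) * (width_n n (simplex_n n) U - 2 * u_seq n / sqrt (real n)) = X n U + Y n U" for n U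
    by (cases "n = 0") (auto simp: X_def Y_def width_simplex_n algebra_simps)
  have lim: "(\<lambda>n. measure (sphere_unif n) {U\<in>space (sphere_unif n). X n U \<le> x \<and> Y n U \<le> y}) \<longlonglongrightarrow> cdf G x * cdf G y" for x y
  proof -
    define a where "a z n = u_seq n + z / sqrt (2 * ln n)" for z and n :: nat
    have "(\<lambda>n. measure (sphere_unif n) {U\<in>space (lebesgue_n n). \<forall>i<n. - (a y n / sqrt n) \<le> U i \<and> U i \<le> a x n / sqrt n})
        \<longlonglongrightarrow> exp (- (exp (ln (2 * sqrt pi) - x) / (2 * sqrt pi) + exp (ln (2 * sqrt pi) - y) / (2 * sqrt pi)))"
      unfolding a_def by (intro sphere_unif_box_tendsto gumbel_level_u_seq)
    \<comment> \<open>The exponent is a sum of one term per side of the box, which is the asymptotic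
      independence.\<close>
    also have "exp (- (exp (ln (2 * sqrt pi) - x) / (2 * sqrt pi) + exp (ln (2 * sqrt pi) - y) / (2 * sqrt pi))) = cdf G x * cdf G y"
      by (simp add: cdf exp_diff exp_minus inverse_eq_divide exp_add[symmetric])
    finally have L: "(\<lambda>n. measure (sphere_unif n) {U\<in>space (lebesgue_n n). \<forall>i<n. - (a y n / sqrt n) \<le> U i \<and> U i \<le> a x n / sqrt n})
        \<longlonglongrightarrow> cdf G x * cdf G y" .
    have "\<forall>\<^sub>F n in sequentially. measure (sphere_unif n) {U\<in>space (lebesgue_n n). \<forall>i<n. - (a y n / sqrt n) \<le> U i \<and> U i \<le> a x n / sqrt n}
      = measure (sphere_unif n) {U\<in>space (sphere_unif n). X n U \<le> x \<and> Y n U \<le> y}"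
      using eventually_gt_at_top[of 1]
    proof eventually_elim
      case (elim n)
      have ne: "{..<n} \<noteq> {}" using elim by auto
      have "X n U \<le> x \<longleftrightarrow> (\<forall>i<n. U i \<le> a x n / sqrt n)" for U
        unfolding X_def rescaled_le_iff[OF elim] a_def using ne by (subst Max_le_iff) auto
      moreover have "Y n U \<le> y \<longleftrightarrow> (\<forall>i<n. - (a y n / sqrt n) \<le> U i)" for U
        unfolding Y_def rescaled_le_iff[OF elim] a_def minus_le_iff[of "Min _"] using ne by (subst Min_ge_iff) auto
      ultimately show ?case
        by (intro arg_cong2[where f=measure] refl) (auto simp: space_sphere_unif)
    qed
    with L show ?thesis by (rule Lim_transform_eventually)
  qed
  have "weak_conv_m (\<lambda>n. distr (sphere_unif n) borel (\<lambda>U. X n U + Y n U)) (G \<star> G)"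
  proof (rule weak_conv_m_add_convolution[OF G _ _ _ lim])
    show "\<forall>\<^sub>F n in sequentially. prob_space (sphere_unif n)"
      by (simp add: prob_space_sphere_unif)
    show "\<forall>\<^sub>F n in sequentially. X n \<in> borel_measurable (sphere_unif n)"
      "\<forall>\<^sub>F n in sequentially. Y n \<in> borel_measurable (sphere_unif n)"
      unfolding X_def[abs_def] Y_def[abs_def]
      by (intro always_eventually allI borel_measurable_times borel_measurable_diff borel_measurable_uminus
          borel_measurable_const measurable_Max_sphere_unif measurable_Min_sphere_unif)+
  qed
  then show ?thesis by (simp add: XY)
qed

text \<open>A bound on the width is a symmetric box, so its distribution function converges
  directly, without a joint law.\<close>

lemma crosspoly_width_weak_conv:
  assumes G: "real_distribution G" and cdf: "\<And>x. cdf G x = exp (- exp (- x))"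
  shows "weak_conv_m
           (\<lambda>n. distr (sphere_unif n) borel
              (\<lambda>U. sqrt (2 * real n * ln (real n)) *
                   (width_n n (crosspoly_n n) U - 2 * u_seq (2 * n) / sqrt (real n))))
           (distr G borel (\<lambda>x. 2 * x))"
  unfolding weak_conv_m_def weak_conv_def
proof (intro allI impI)
  interpret G: real_distribution G by fact
  fix z :: real
  define f where "f n U = sqrt (2 * real n * ln (real n)) * (width_n n (crosspoly_n n) U - 2 * u_seq (2 * n) / sqrt (real n))" for n U
  \<comment> \<open>The argument is \<open>z / 2\<close> because the width is twice the largest
    modulus of a coordinate; this is also the source of the factor 2 in the limit.\<close>
  define a where "a n = u_seq (2 * n) + (z / 2) / sqrt (2 * ln n)" for n :: nat
  have "cdf (distr G borel (\<lambda>x. 2 * x)) z = measure G {..z / 2}"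
    unfolding cdf_def by (subst measure_distr) (auto intro!: arg_cong2[where f=measure])
  then have cdf2: "cdf (distr G borel (\<lambda>x. 2 * x)) z = exp (- exp (- (z / 2)))"
    using cdf[of "z / 2"] by (simp add: cdf_def)
  have "(\<lambda>n. measure (sphere_unif n) {U\<in>space (lebesgue_n n). \<forall>i<n. - (a n / sqrt n) \<le> U i \<and> U i \<le> a n / sqrt n})
      \<longlonglongrightarrow> exp (- (exp (ln (2 * sqrt pi) - ln 2 - z / 2) / (2 * sqrt pi) + exp (ln (2 * sqrt pi) - ln 2 - z / 2) / (2 * sqrt pi)))"
    unfolding a_def by (intro sphere_unif_box_tendsto gumbel_level_u_seq_double)
  also have "exp (- (exp (ln (2 * sqrt pi) - ln 2 - z / 2) / (2 * sqrt pi) + exp (ln (2 * sqrt pi) - ln 2 - z / 2) / (2 * sqrt pi)))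
      = exp (- exp (- (z / 2)))"
    by (simp add: exp_diff exp_minus inverse_eq_divide)
  finally have L: "(\<lambda>n. measure (sphere_unif n) {U\<in>space (lebesgue_n n). \<forall>i<n. - (a n / sqrt n) \<le> U i \<and> U i \<le> a n / sqrt n})
      \<longlonglongrightarrow> cdf (distr G borel (\<lambda>x. 2 * x)) z"
    unfolding cdf2 .
  have "\<forall>\<^sub>F n in sequentially. measure (sphere_unif n) {U\<in>space (lebesgue_n n). \<forall>i<n. - (a n / sqrt n) \<le> U i \<and> U i \<le> a n / sqrt n}
    = cdf (distr (sphere_unif n) borel (f n)) z"
    using eventually_gt_at_top[of 1]
  proof eventually_elim
    case (elim n)
    have ne: "{..<n} \<noteq> {}" using elim by auto
    have f_eq: "f n U = 2 * (sqrt (2 * real n * ln n) * (Max ((\<lambda>i. \<bar>U i\<bar>) ` {..<n}) - u_seq (2 * n) / sqrt n))" for U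
      using elim by (simp add: f_def width_crosspoly_n algebra_simps)
    have f_meas: "f n \<in> borel_measurable (sphere_unif n)"
      unfolding f_eq[abs_def] by (intro borel_measurable_times borel_measurable_diff
          borel_measurable_const measurable_Max_abs_sphere_unif)
    have "f n U \<le> z \<longleftrightarrow> sqrt (2 * real n * ln n) * (Max ((\<lambda>i. \<bar>U i\<bar>) ` {..<n}) - u_seq (2 * n) / sqrt n) \<le> z / 2" for U
      unfolding f_eq by linarith
    then have "f n U \<le> z \<longleftrightarrow> (\<forall>i<n. \<bar>U i\<bar> \<le> a n / sqrt n)" for U
      unfolding rescaled_le_iff[OF elim] a_def using ne by (subst (asm) Max_le_iff) auto
    then have "f n -` {..z} \<inter> space (sphere_unif n) = {U\<in>space (lebesgue_n n). \<forall>i<n. - (a n / sqrt n) \<le> U i \<and> U i \<le> a n / sqrt n}"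
      by (auto simp: space_sphere_unif abs_le_iff minus_le_iff)
    then show ?case
      unfolding cdf_def using f_meas by (subst measure_distr) auto
  qed
  with L show "(\<lambda>n. cdf (distr (sphere_unif n) borel (\<lambda>U. sqrt (2 * real n * ln (real n)) *
                   (width_n n (crosspoly_n n) U - 2 * u_seq (2 * n) / sqrt (real n)))) z)
      \<longlonglongrightarrow> cdf (distr G borel (\<lambda>x. 2 * x)) z"
    unfolding f_def[abs_def] by (rule Lim_transform_eventually)
qed

theorem theorem3p3:
  fixes G :: "real measure"
  assumes "real_distribution G"
    and "\<And>x. cdf G x = exp (- exp (- x))"
  shows "weak_conv_m
           (\<lambda>n. distr (sphere_unif n) borel
              (\<lambda>U. sqrt (2 * real n * ln (real n)) *
                   (width_n n (simplex_n n) U - 2 * u_seq n / sqrt (real n))))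
           (G \<star> G)
       \<and> weak_conv_m
           (\<lambda>n. distr (sphere_unif n) borel
              (\<lambda>U. sqrt (2 * real n * ln (real n)) *
                   (width_n n (crosspoly_n n) U - 2 * u_seq (2 * n) / sqrt (real n))))
           (distr G borel (\<lambda>x. 2 * x))"
  using simplex_width_weak_conv[OF assms] crosspoly_width_weak_conv[OF assms] by (rule conjI)

end
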